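(* Let $x\sim\mathcal{N}(\mu,\Sigma)$ be a Gaussian signal in $\mathbb{R}^n$, and let $\lambda_1,\dots,\lambda_n$ denote the eigenvalues of $\Sigma_w^{-1}\Sigma$ with multiplicities, where $\Sigma_w$ is the (full rank) noise covariance matrix. Assume $w\sim\mathcal{N}(0,\Sigma_w)$ is colored Gaussian noise added prior to the measurement ("noise folding"), $y=A(x+w)$. Furthermore, let $\varepsilon>0$ be the required accuracy. Then the Info-Greedy Sensing algorithm described in the context recovers $x$, i.e. returns $\widehat{x}$ satisfying $\|x-\widehat{x}\|_2<\varepsilon$, with probability at least $p$, using at most the following number of measurements by unit vectors $\|a_i\|_2=1$: $$m=\sum_{\substack{i=1\\ \lambda_i\neq0}}^{n}\max\left\{0,\left\lceil\frac{\chi_n^2(p)}{\varepsilon^2}\|\Sigma_w\|-\frac{1}{\lambda_i}\right\rceil\right\}.$$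
   Context: The parameters $\mu,\Sigma$ are known. $A$ is the sensing matrix whose rows are the measurement vectors $a_i^{\intercal}$, chosen sequentially. $\chi_n^2(\cdot)$ is the quantile function of the chi-squared distribution with $n$ degrees of freedom, and $\|\cdot\|$ of a matrix denotes its largest eigenvalue. Resource convention: in the noise-folding model scaling a measurement vector does not change the signal-to-noise ratio, so measurement vectors are taken of unit norm and the amount of resource (power) $\beta$ allocated to a unit direction $u$, written $a=\sqrt{\beta}\,u$, is counted as the number of repeated measurements in the direction $u$. Info-Greedy Sensing algorithm for Gaussian signals, colored noise added prior to measurement. Input: signal mean $\mu$ and covariance $\Sigma$, accuracy $\varepsilon$, probability of correctness $p$, noise covariance matrix $\Sigma_w$. Repeat the following steps: (1) $\lambda\leftarrow\|\Sigma_w^{-1}\Sigma\|$ (largest eigenvalue); (2) $\beta\leftarrow\frac{\chi_n^2(p)}{\varepsilon^2}\|\Sigma_w\|-\frac1\lambda$; (3) $u\leftarrow$ eigenvector of $\Sigma_w^{-1}\Sigma$ for the eigenvalue $\lambda$; (4) $a\leftarrow\sqrt{\beta}\,u$; (5) measure $y=a^{\intercal}(x+w)$; (6) update the mean, $\mu\leftarrow\mu+\Sigma a(a^{\intercal}\Sigma a+\sigma^2)^{-1}(y-a^{\intercal}\mu)$, and the covariance, $\Sigma\leftarrow\Sigma-\Sigma a(a^{\intercal}\Sigma a+\sigma^2)^{-1}a^{\intercal}\Sigma$, where $\sigma^2$ stands for the noise variance $u^{\intercal}\Sigma_w u$ in the unit direction $u$; until $\|\Sigma\|\le\varepsilon^2/\chi_n^2(p)$.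 Return the posterior mean $\mu$ as $\widehat{x}$. *)

theory Defs
  imports
    "HOL-Probability.Probability"
    "HOL-Library.While_Combinator"
    "HOL-Computational_Algebra.Polynomial"
begin

section \<open>Eigenvalues\<close>

definition eigenvalues :: "real^'n^'n \<Rightarrow> real set" where
  "eigenvalues A = {l. \<exists>v. v \<noteq> 0 \<and> A *v v = l *\<^sub>R v}"

definition max_eigenvalue :: "real^'n^'n \<Rightarrow> real" where
  "max_eigenvalue A = Max (eigenvalues A)"

definition charpoly :: "real^'n^'n \<Rightarrow> real poly" where
  "charpoly A = det (mat [:0, 1:] - map_matrix (\<lambda>c. [:c:]) A)"

text \<open>A (deterministic, otherwise arbitrary) eigenvector routine: whenever a matrix has a real
  eigenvalue, it returns some unit eigenvector for the largest one.\<close>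

definition top_eigenvector_rule :: "(real^'n^'n \<Rightarrow> real^'n) \<Rightarrow> bool" where
  "top_eigenvector_rule pick \<longleftrightarrow>
     (\<forall>A. eigenvalues A \<noteq> {} \<longrightarrow>
        norm (pick A) = 1 \<and> A *v pick A = max_eigenvalue A *\<^sub>R pick A)"

section \<open>Gaussian vectors and the chi-squared quantile\<close>

definition covariance_matrix :: "real^'n^'n \<Rightarrow> bool" where
  "covariance_matrix S \<longleftrightarrow> transpose S = S \<and> (\<forall>v. 0 \<le> v \<bullet> (S *v v))"

definition normal_law :: "real \<Rightarrow> real \<Rightarrow> real measure" where
  "normal_law m s2 =
     (if s2 = 0 then return borel m else density lborel (normal_density m (sqrt s2)))"

text \<open>The covariance matrix may be singular, so a Gaussian vector is characterised by its linear
  functionals (a Lebesgue density need not exist).\<close>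

definition gaussian_vector ::
    "'a measure \<Rightarrow> ('a \<Rightarrow> real^'n) \<Rightarrow> real^'n \<Rightarrow> real^'n^'n \<Rightarrow> bool" where
  "gaussian_vector P X m S \<longleftrightarrow>
     X \<in> borel_measurable P \<and> covariance_matrix S \<and>
     (\<forall>v. distr P borel (\<lambda>\<omega>. v \<bullet> X \<omega>) = normal_law (v \<bullet> m) (v \<bullet> (S *v v)))"

definition chi_squared :: "nat \<Rightarrow> real measure" where
  "chi_squared n =
     distr (PiM {..<n} (\<lambda>_. density lborel std_normal_density)) borel (\<lambda>z. \<Sum>i<n. (z i)\<^sup>2)"

definition chi_squared_quantile :: "nat \<Rightarrow> real \<Rightarrow> real" where
  "chi_squared_quantile n p = Inf {t. p \<le> cdf (chi_squared n) t}"

section \<open>Info-Greedy Sensing, colored noise added prior to measurement\<close>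

text \<open>
  A state is (current mean, current covariance, number of unit-norm measurements taken so far).
  The algorithm sees the signal only through the sensing oracle \<open>sense j u\<close>, the response of the
  \<open>j\<close>-th measurement, taken with the unit vector \<open>u\<close>.

  The power \<open>\<beta>\<close> is a number of repeated measurements, hence it is rounded up to a natural number
  \<open>k\<close> (and \<open>k = 0\<close> if \<open>\<beta> \<le> 0\<close>; also if \<open>\<lambda> = 0\<close>, where \<open>1/\<lambda>\<close> is \<open>\<infinity>\<close> and \<open>\<beta>\<close> is \<open>-\<infinity>\<close>).
  With \<open>a = sqrt k u\<close>, the \<open>k\<close> responses \<open>u \<bullet> (x + w j)\<close> combine to
  \<open>y = (\<Sum>j. u \<bullet> (x + w j)) / sqrt k = a \<bullet> (x + (mean of the k noise vectors))\<close>,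
  whose noise part has variance \<open>\<sigma>\<^sup>2 = u \<bullet> \<Sigma>\<^sub>w u\<close>.
\<close>

definition info_greedy_step ::
    "(real^'n^'n \<Rightarrow> real^'n) \<Rightarrow> real \<Rightarrow> real \<Rightarrow> real^'n^'n \<Rightarrow> (nat \<Rightarrow> real^'n \<Rightarrow> real) \<Rightarrow>
     (real^'n) \<times> (real^'n^'n) \<times> nat \<Rightarrow> (real^'n) \<times> (real^'n^'n) \<times> nat" where
  "info_greedy_step pick eps p Sw sense = (\<lambda>(mu, S, m).
     let lam = max_eigenvalue (matrix_inv Sw ** S);
         beta = chi_squared_quantile CARD('n) p / eps\<^sup>2 * max_eigenvalue Sw - 1 / lam;
         k = (if lam = 0 then 0 else nat \<lceil>beta\<rceil>);
         u = pick (matrix_inv Sw ** S);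
         a = sqrt (real k) *\<^sub>R u;
         y = (\<Sum>j = m..<m + k. sense j u) / sqrt (real k);
         sigma2 = u \<bullet> (Sw *v u);
         g = inverse (a \<bullet> (S *v a) + sigma2)
     in (mu + (g * (y - a \<bullet> mu)) *\<^sub>R (S *v a),
         S - g *\<^sub>R (columnvector (S *v a) ** (rowvector (a v* S) :: real^'n^1)),
         m + k))"

definition info_greedy_stop :: "real \<Rightarrow> real \<Rightarrow> (real^'n) \<times> (real^'n^'n) \<times> nat \<Rightarrow> bool" where
  "info_greedy_stop eps p = (\<lambda>(mu, S, m).
     max_eigenvalue S \<le> eps\<^sup>2 / chi_squared_quantile CARD('n) p)"

text \<open>Repeat-until: the body is executed once before the stopping test is first evaluated.
  The value is \<open>None\<close> if the loop does not terminate.\<close>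

definition info_greedy ::
    "(real^'n^'n \<Rightarrow> real^'n) \<Rightarrow> real \<Rightarrow> real \<Rightarrow> real^'n^'n \<Rightarrow> real^'n \<Rightarrow> real^'n^'n \<Rightarrow>
     (nat \<Rightarrow> real^'n \<Rightarrow> real) \<Rightarrow> ((real^'n) \<times> (real^'n^'n) \<times> nat) option" where
  "info_greedy pick eps p Sw mu S sense =
     while_option (\<lambda>s. \<not> info_greedy_stop eps p s) (info_greedy_step pick eps p Sw sense)
       (info_greedy_step pick eps p Sw sense (mu, S, 0))"

end

theory Submission
  imports Defs
begin

text \<open>
  Diagonalise \<open>\<Sigma>\<close> in a \<open>\<Sigma>\<^sub>w\<close>-orthonormal basis that contains a multiple of the direction about to be
  measured. Measuring this direction \<open>k\<close> times replaces its eigenvalue \<open>\<lambda>\<close> of \<open>\<Sigma>\<^sub>w\<^sup>-\<^sup>1 \<Sigma>\<close> by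
  \<open>1 / (k + 1/\<lambda>)\<close> and leaves the others alone; with the \<open>k\<close> of the algorithm, no further
  measurement is charged to the new eigenvalue. Hence every eigenvalue is paid for at most once.
  Once no eigenvalue requires measurements, \<open>v \<bullet> \<Sigma> v \<le> \<lambda> (v \<bullet> \<Sigma>\<^sub>w v)\<close> for the largest \<open>\<lambda>\<close> gives the
  stopping criterion.

  The error of the estimate is a centred Gaussian vector whose covariance is the final \<open>\<Sigma>\<close>, so its
  squared length is distributed like \<open>\<Sum>i. d\<^sub>i Z\<^sub>i\<^sup>2\<close> with the eigenvalues \<open>d\<^sub>i\<close> of \<open>\<Sigma>\<close> and independent
  standard normal \<open>Z\<^sub>i\<close>. As \<open>d\<^sub>i \<le> \<epsilon>\<^sup>2 / \<chi>\<^sub>n\<^sup>2(p)\<close>, it is below \<open>\<epsilon>\<^sup>2\<close> with probability at least \<open>p\<close>.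
\<close>

section \<open>Simultaneous diagonalisation\<close>

lemma symmetric_matrix_inner:
  fixes A :: "real^'n^'n"
  assumes "transpose A = A"
  shows "x \<bullet> (A *v y) = y \<bullet> (A *v x)"
  by (metis assms dot_lmul_matrix inner_commute vector_transpose_matrix)

text \<open>The quadratic has a minimum at \<open>t = 0\<close>, where it vanishes, so its
  derivative \<open>2 * r\<close> there must be zero.\<close>

lemma psd_quadratic_form_zero:
  fixes q r :: real
  assumes "\<And>t. 0 \<le> 2 * t * r + t\<^sup>2 * q"
  shows "r = 0"
proof -
  \<comment> \<open>Any positive \<open>k\<close> with \<open>q < 2 * k\<close> would do: at
    \<open>t = - r / k\<close> the quadratic equals \<open>t\<^sup>2 * (q - 2 * k)\<close>.\<close>
  define k where "k = \<bar>q\<bar> + 1"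
  define t where "t = - r / k"
  have k: "k > 0" "q < 2 * k" by (auto simp: k_def)
  have r: "r = - k * t" using k by (simp add: t_def)
  have "0 \<le> t\<^sup>2 * (q - 2 * k)"
    using assms[of t] by (simp add: r power2_eq_square algebra_simps)
  then have "t = 0" using k by (simp add: zero_le_mult_iff)
  then show ?thesis by (simp add: r)
qed

text \<open>First-order condition at the minimum \<open>v\<close> of the form on \<open>V\<close>,
  taken along the line \<open>v + t *\<^sub>R z\<close>.\<close>

lemma psd_form_zero_on_subspace:
  fixes A :: "real^'n^'n"
  assumes sym: "transpose A = A" and V: "subspace V"
    and psd: "\<And>z. z \<in> V \<Longrightarrow> 0 \<le> z \<bullet> (A *v z)"
    and v: "v \<in> V" "v \<bullet> (A *v v) = 0" and z: "z \<in> V"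
  shows "z \<bullet> (A *v v) = 0"
proof (rule psd_quadratic_form_zero)
  fix t :: real
  have "v + t *\<^sub>R z \<in> V" using V v z by (simp add: subspace_add subspace_scale)
  from psd[OF this] show "0 \<le> 2 * t * (z \<bullet> (A *v v)) + t\<^sup>2 * (z \<bullet> (A *v z))"
    using v(2) symmetric_matrix_inner[OF sym, of v z]
    by (simp add: matrix_vector_right_distrib matrix_vector_mult_scaleR inner_add_left
        inner_add_right power2_eq_square algebra_simps)
qed

text \<open>A zero of a semidefinite form lies in the kernel of its matrix, and this kernel is
  trivial.\<close>

lemma covariance_matrix_invertible_pos:
  assumes "covariance_matrix W" "invertible W" "v \<noteq> 0"
  shows "0 < v \<bullet> (W *v v)"
proof (rule ccontr)
  assume "\<not> ?thesis"
  with assms(1) have 0: "v \<bullet> (W *v v) = 0"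
    unfolding covariance_matrix_def by (meson not_less order_antisym)
  have "(W *v v) \<bullet> (W *v v) = 0"
    by (rule psd_form_zero_on_subspace[where V = UNIV])
      (use assms(1) 0 in \<open>auto simp: covariance_matrix_def\<close>)
  then have "W *v v = 0" by simp
  then have "v = 0" using assms(2)
    by (metis matrix_left_invertible_ker invertible_def)
  with assms(3) show False by simp
qed

text \<open>These are generalised eigenvectors, orthonormal for the form of \<open>W\<close>: for
  invertible \<open>W\<close> they are eigenvectors of \<open>matrix_inv W ** S\<close>, which need
  not be symmetric, and for \<open>W = mat 1\<close> ordinary orthonormal eigenvectors. The index
  set \<open>I\<close> allows partial families that are extended later.\<close>

definition pencil_eigenfamily ::
    "real^'n^'n \<Rightarrow> real^'n^'n \<Rightarrow> 'n set \<Rightarrow> ('n \<Rightarrow> real^'n) \<Rightarrow> ('n \<Rightarrow> real) \<Rightarrow> bool" where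
  "pencil_eigenfamily W S I b d \<longleftrightarrow>
     (\<forall>i\<in>I. S *v b i = d i *\<^sub>R (W *v b i)) \<and>
     (\<forall>i\<in>I. \<forall>j\<in>I. b i \<bullet> (W *v b j) = (if i = j then 1 else 0))"

text \<open>The vector is a maximiser of the Rayleigh quotient of \<open>S\<close> against
  \<open>W\<close> on the \<open>W\<close>-orthogonal complement of the family, and \<open>l\<close>
  is the maximum.\<close>

lemma pencil_eigenvector_orthogonal:
  fixes W S :: "real^'n^'n"
  assumes W: "transpose W = W" "\<And>v. v \<noteq> 0 \<Longrightarrow> 0 < v \<bullet> (W *v v)"
    and S: "transpose S = S"
    and fam: "pencil_eigenfamily W S I b d" and I: "I \<noteq> UNIV"
  obtains v l where "\<And>i. i \<in> I \<Longrightarrow> b i \<bullet> (W *v v) = 0" "v \<bullet> (W *v v) = 1"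
    "S *v v = l *\<^sub>R (W *v v)"
proof -
  \<comment> \<open>The \<open>W\<close>-orthogonal complement, written as the Euclidean complement
    of the vectors \<open>W *v b i\<close>; fewer than \<open>CARD('n)\<close> of them leave room
    for a nonzero vector.\<close>
  define V where "V = {v. \<forall>i\<in>I. (W *v b i) \<bullet> v = 0}"
  have V_iff: "v \<in> V \<longleftrightarrow> (\<forall>i\<in>I. b i \<bullet> (W *v v) = 0)" for v
    unfolding V_def using symmetric_matrix_inner[OF W(1)] by (auto simp: inner_commute)
  have V: "subspace V" unfolding V_def subspace_def by (auto simp: inner_right_distrib)
  have "dim (span ((\<lambda>i. W *v b i) ` I)) < DIM(real^'n)"
  proof -
    have "dim (span ((\<lambda>i. W *v b i) ` I)) \<le> card ((\<lambda>i. W *v b i) ` I)"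
      by (simp add: dim_le_card')
    also have "\<dots> \<le> card I" by (rule card_image_le) simp
    also have "\<dots> < CARD('n)" using I by (metis finite psubsetI psubset_card_mono subset_UNIV)
    finally show ?thesis by simp
  qed
  from orthogonal_to_subspace_exists[OF this]
  obtain v0 where v0: "v0 \<noteq> 0" "\<And>y. y \<in> span ((\<lambda>i. W *v b i) ` I) \<Longrightarrow> orthogonal v0 y"
    by (metis span_span)
  then have v0V: "v0 \<in> V"
    unfolding V_def by (auto simp: orthogonal_def intro: span_base) (metis image_eqI inner_commute span_base)
  define K where "K = V \<inter> sphere 0 1"
  have K_pos: "\<forall>v\<in>K. v \<bullet> (W *v v) \<noteq> 0"
  proof
    fix v assume "v \<in> K"
    then have "v \<noteq> 0" by (auto simp: K_def)
    from W(2)[OF this] show "v \<bullet> (W *v v) \<noteq> 0" by simp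
  qed
  have "compact K" unfolding K_def
    by (intro closed_Int_compact closed_subspace V compact_sphere)
  moreover have "v0 /\<^sub>R norm v0 \<in> K"
    unfolding K_def using v0 v0V V by (simp add: subspace_scale)
  moreover have "continuous_on K (\<lambda>v. (v \<bullet> (S *v v)) / (v \<bullet> (W *v v)))"
    by (intro continuous_intros matrix_vector_mult_linear_continuous_on linear_continuous_on
        linear_conv_bounded_linear[THEN iffD1])
       (rule K_pos)
  ultimately obtain m where m: "m \<in> K"
    "\<And>v. v \<in> K \<Longrightarrow> (v \<bullet> (S *v v)) / (v \<bullet> (W *v v)) \<le> (m \<bullet> (S *v m)) / (m \<bullet> (W *v m))"
    using continuous_attains_sup[of K] by blast
  define l where "l = (m \<bullet> (S *v m)) / (m \<bullet> (W *v m))"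
  have mV: "m \<in> V" and m0: "m \<noteq> 0" using m(1) by (auto simp: K_def)
  \<comment> \<open>As \<open>l\<close> is the maximal quotient, the form of \<open>Q\<close> is
    nonnegative on \<open>V\<close> and zero at \<open>m\<close>, so \<open>Q *v m\<close> is
    orthogonal to \<open>V\<close>. It is orthogonal to each \<open>b i\<close> as well, and these
    vectors together with \<open>V\<close> span the space.\<close>
  define Q where "Q = l *\<^sub>R W - S"
  have Qv: "Q *v z = l *\<^sub>R (W *v z) - S *v z" for z
    unfolding Q_def by (simp add: matrix_vector_mult_diff_rdistrib scaleR_matrix_vector_assoc)
  have Qs: "transpose Q = Q"
    using W(1) S unfolding Q_def by (simp add: transpose_def vec_eq_iff)
  have psd: "0 \<le> z \<bullet> (Q *v z)" if "z \<in> V" for z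
  proof (cases "z = 0")
    case False
    have "z /\<^sub>R norm z \<in> K" unfolding K_def using False that V by (simp add: subspace_scale)
    from m(2)[OF this] have "(z \<bullet> (S *v z)) / (z \<bullet> (W *v z)) \<le> l"
      using False by (simp add: matrix_vector_mult_scaleR l_def)
    then show ?thesis using W(2)[OF False] by (simp add: Qv inner_diff_right field_simps)
  qed simp
  have Qm: "m \<bullet> (Q *v m) = 0" using W(2)[OF m0] by (simp add: Qv inner_diff_right l_def)
  have ortho: "z \<bullet> (Q *v m) = 0" if "z \<in> V" for z
    by (rule psd_form_zero_on_subspace[OF Qs V psd mV Qm that])
  have bQ: "b i \<bullet> (Q *v m) = 0" if "i \<in> I" for i
  proof -
    have "b i \<bullet> (W *v m) = 0" using mV that V_iff by blast
    then have "(W *v b i) \<bullet> m = 0" using symmetric_matrix_inner[OF W(1), of m "b i"]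
      by (simp add: inner_commute)
    moreover have "b i \<bullet> (S *v m) = d i * ((W *v b i) \<bullet> m)"
      using symmetric_matrix_inner[OF S, of "b i" m] fam that
      by (simp add: pencil_eigenfamily_def inner_commute)
    ultimately show ?thesis using \<open>b i \<bullet> (W *v m) = 0\<close> by (simp add: Qv inner_diff_right)
  qed
  have "z \<bullet> (Q *v m) = 0" for z
  proof -
    \<comment> \<open>\<open>z'\<close> is the \<open>W\<close>-orthogonal projection of
      \<open>z\<close> onto the span of the family, so the rest lies in \<open>V\<close>.\<close>
    define z' where "z' = (\<Sum>i\<in>I. (b i \<bullet> (W *v z)) *\<^sub>R b i)"
    have "z - z' \<in> V" unfolding V_iff
    proof
      fix i assume i: "i \<in> I"
      have "b i \<bullet> (W *v z') = (\<Sum>j\<in>I. (b j \<bullet> (W *v z)) * (b i \<bullet> (W *v b j)))"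
        unfolding z'_def by (simp add: matrix_vector_mult_scaleR inner_sum_right
            linear_sum[OF matrix_vector_mul_linear])
      also have "\<dots> = (\<Sum>j\<in>I. if i = j then b j \<bullet> (W *v z) else 0)"
        by (rule sum.cong) (use fam i in \<open>auto simp: pencil_eigenfamily_def\<close>)
      also have "\<dots> = b i \<bullet> (W *v z)" using i by simp
      finally show "b i \<bullet> (W *v (z - z')) = 0"
        by (simp add: matrix_vector_mult_diff_distrib inner_diff_right)
    qed
    from ortho[OF this] have "z \<bullet> (Q *v m) = z' \<bullet> (Q *v m)" by (simp add: inner_diff_left)
    also have "\<dots> = 0" unfolding z'_def using bQ by (simp add: inner_sum_left)
    finally show ?thesis .
  qed
  then have "Q *v m = 0" using inner_eq_zero_iff by blast
  then have Sm: "S *v m = l *\<^sub>R (W *v m)" by (simp add: Qv)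
  define r where "r = sqrt (m \<bullet> (W *v m))"
  have r: "r > 0" "r * r = m \<bullet> (W *v m)" using W(2)[OF m0] by (auto simp: r_def)
  show thesis
  proof (rule that[of "m /\<^sub>R r" l])
    show "b i \<bullet> (W *v (m /\<^sub>R r)) = 0" if "i \<in> I" for i
      using mV that V_iff by (simp add: matrix_vector_mult_scaleR)
    show "(m /\<^sub>R r) \<bullet> (W *v (m /\<^sub>R r)) = 1"
      unfolding matrix_vector_mult_scaleR inner_scaleR_left inner_scaleR_right r(2)[symmetric]
      using r(1) by (simp add: field_simps)
    show "S *v (m /\<^sub>R r) = l *\<^sub>R (W *v (m /\<^sub>R r))"
      using Sm by (simp add: matrix_vector_mult_scaleR)
  qed
qed

text \<open>Adds one vector at a time, by induction on the number of missing indices. Prescribed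
  vectors are kept, so a chosen measurement direction can be made part of the basis.\<close>

lemma pencil_eigenfamily_extend:
  fixes W S :: "real^'n^'n"
  assumes W: "transpose W = W" "\<And>v. v \<noteq> 0 \<Longrightarrow> 0 < v \<bullet> (W *v v)"
    and S: "transpose S = S"
    and fam: "pencil_eigenfamily W S I b d"
  obtains b' d' where "pencil_eigenfamily W S UNIV b' d'"
    "\<And>i. i \<in> I \<Longrightarrow> b' i = b i" "\<And>i. i \<in> I \<Longrightarrow> d' i = d i"
  using fam
proof (induction "card (- I)" arbitrary: I b d thesis rule: less_induct)
  case less
  show ?case
  proof (cases "I = UNIV")
    case True
    then show ?thesis using less.prems by blast
  next
    case False
    then obtain i0 where i0: "i0 \<notin> I" by blast
    obtain v l where v: "\<And>i. i \<in> I \<Longrightarrow> b i \<bullet> (W *v v) = 0" "v \<bullet> (W *v v) = 1"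
      "S *v v = l *\<^sub>R (W *v v)"
      using pencil_eigenvector_orthogonal[OF W S less.prems(2) False] by blast
    have v': "v \<bullet> (W *v b i) = 0" if "i \<in> I" for i
      using v(1)[OF that] symmetric_matrix_inner[OF W(1), of v "b i"] by simp
    have "pencil_eigenfamily W S (insert i0 I) (b(i0 := v)) (d(i0 := l))"
      using less.prems(2) v v' i0 unfolding pencil_eigenfamily_def by auto
    moreover have "card (- insert i0 I) < card (- I)"
      using i0 by (intro psubset_card_mono) auto
    ultimately obtain b' d' where "pencil_eigenfamily W S UNIV b' d'"
      "\<And>i. i \<in> insert i0 I \<Longrightarrow> b' i = (b(i0 := v)) i"
      "\<And>i. i \<in> insert i0 I \<Longrightarrow> d' i = (d(i0 := l)) i"
      using less.hyps[of "insert i0 I" "b(i0 := v)" "d(i0 := l)"] by blast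
    then show ?thesis using less.prems(1)[of b' d'] i0 by (metis fun_upd_other insertI2)
  qed
qed

text \<open>\<open>B\<close> has the basis vectors as columns, and \<open>W\<close>-orthonormality
  says that \<open>transpose B ** W\<close>, the coordinate map, is its inverse.\<close>

lemma pencil_eigenbasis_matrix:
  fixes W S :: "real^'n^'n"
  assumes fam: "pencil_eigenfamily W S UNIV b d"
  obtains B L :: "real^'n^'n" where "L ** B = mat 1" "B ** L = mat 1"
    "\<And>z i. (L *v z) $ i = b i \<bullet> (W *v z)" "\<And>i j. B $ i $ j = b j $ i"
proof -
  define B :: "real^'n^'n" where "B = (\<chi> i j. b j $ i)"
  define L where "L = transpose B ** W"
  have L: "(L *v z) $ i = b i \<bullet> (W *v z)" for z i
    unfolding L_def matrix_vector_mul_assoc[symmetric]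
    by (simp add: B_def transpose_def inner_vec_def matrix_vector_mult_def[of "transpose _"]
        matrix_vector_mult_def[of "vec_lambda _"])
  have "L ** B = mat 1"
  proof -
    have "(L ** B) $ i $ j = (L *v b j) $ i" for i j
      by (simp add: matrix_matrix_mult_def matrix_vector_mult_def B_def)
    then show ?thesis
      using fam by (simp add: vec_eq_iff L mat_def pencil_eigenfamily_def)
  qed
  moreover from this have "B ** L = mat 1" by (simp add: matrix_left_right_inverse)
  ultimately show thesis using L by (rule that) (simp add: B_def)
qed

lemma pencil_eigenbasis_expansion:
  fixes W S :: "real^'n^'n"
  assumes fam: "pencil_eigenfamily W S UNIV b d"
  shows "z = (\<Sum>i\<in>UNIV. (b i \<bullet> (W *v z)) *\<^sub>R b i)"
proof -
  obtain B L :: "real^'n^'n" where BL: "B ** L = mat 1"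
    "\<And>z i. (L *v z) $ i = b i \<bullet> (W *v z)" "\<And>i j. B $ i $ j = b j $ i"
    by (rule pencil_eigenbasis_matrix[OF fam]) blast
  have "z = B *v (L *v z)" by (simp add: matrix_vector_mul_assoc BL)
  also have "\<dots> = (\<Sum>i\<in>UNIV. (b i \<bullet> (W *v z)) *\<^sub>R b i)"
    by (simp add: vec_eq_iff matrix_vector_mult_def[of B] BL mult.commute)
  finally show ?thesis .
qed

lemma pencil_eigenbasis_quadratic:
  fixes W S :: "real^'n^'n"
  assumes fam: "pencil_eigenfamily W S UNIV b d"
    and W: "transpose W = W" and S: "transpose S = S"
  shows "z \<bullet> (W *v z) = (\<Sum>i\<in>UNIV. (b i \<bullet> (W *v z))\<^sup>2)"
    and "z \<bullet> (S *v z) = (\<Sum>i\<in>UNIV. d i * (b i \<bullet> (W *v z))\<^sup>2)"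
proof -
  have inner: "z \<bullet> y = (\<Sum>i\<in>UNIV. (b i \<bullet> (W *v z)) * (b i \<bullet> y))" for y
    using arg_cong[OF pencil_eigenbasis_expansion[OF fam, of z], of "\<lambda>v. v \<bullet> y"]
    by (simp add: inner_sum_left)
  show "z \<bullet> (W *v z) = (\<Sum>i\<in>UNIV. (b i \<bullet> (W *v z))\<^sup>2)"
    using inner[of "W *v z"] by (simp add: power2_eq_square)
  have "b i \<bullet> (S *v z) = d i * (b i \<bullet> (W *v z))" for i
    using fam symmetric_matrix_inner[OF S, of "b i" z] symmetric_matrix_inner[OF W, of "b i" z]
    by (simp add: pencil_eigenfamily_def)
  then show "z \<bullet> (S *v z) = (\<Sum>i\<in>UNIV. d i * (b i \<bullet> (W *v z))\<^sup>2)"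
    using inner[of "S *v z"] by (simp add: power2_eq_square mult_ac)
qed

lemma pencil_eigenbasis_nonneg:
  fixes W S :: "real^'n^'n"
  assumes fam: "pencil_eigenfamily W S UNIV b d" and "\<And>v. 0 \<le> v \<bullet> (S *v v)"
  shows "0 \<le> d i"
  using assms(2)[of "b i"] fam by (simp add: pencil_eigenfamily_def)

section \<open>Spectrum of \<open>matrix_inv W ** S\<close>\<close>

lemma matrix_inv_inverse:
  fixes A :: "real^'n^'n"
  assumes "invertible A"
  shows "A ** matrix_inv A = mat 1" "matrix_inv A ** A = mat 1"
  using someI_ex[OF assms[unfolded invertible_def]] unfolding matrix_inv_def by auto

lemma matrix_inv_mult_vector_eq_iff:
  fixes W :: "real^'n^'n"
  assumes "invertible W"
  shows "matrix_inv W *v y = z \<longleftrightarrow> y = W *v z"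
  using matrix_inv_inverse[OF assms] by (auto simp: matrix_vector_mul_assoc)

text \<open>Pairing an eigenvector \<open>v\<close> for \<open>l\<close> with \<open>b i\<close> in
  two ways gives \<open>l * c = d i * c\<close> for the coordinate
  \<open>c = b i \<bullet> (W *v v)\<close>. If \<open>l\<close> differs from all
  \<open>d i\<close>, all coordinates vanish.\<close>

lemma eigenvalues_pencil:
  fixes W S :: "real^'n^'n"
  assumes fam: "pencil_eigenfamily W S UNIV b d" and "invertible W"
    and W: "transpose W = W" and S: "transpose S = S"
  shows "eigenvalues (matrix_inv W ** S) = range d"
proof -
  have iff: "(matrix_inv W ** S) *v v = l *\<^sub>R v \<longleftrightarrow> S *v v = l *\<^sub>R (W *v v)" for v l
    by (simp add: matrix_vector_mul_assoc[symmetric] matrix_inv_mult_vector_eq_iff assms(2)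
        matrix_vector_mult_scaleR)
  have "l \<in> range d" if "v \<noteq> 0" "S *v v = l *\<^sub>R (W *v v)" for v l
  proof (rule ccontr)
    assume l: "l \<notin> range d"
    have "b i \<bullet> (W *v v) = 0" for i
    proof -
      have "l * (b i \<bullet> (W *v v)) = v \<bullet> (S *v b i)"
        using symmetric_matrix_inner[OF S, of v "b i"] that(2) by simp
      also have "\<dots> = d i * (b i \<bullet> (W *v v))"
        using fam symmetric_matrix_inner[OF W, of v "b i"] by (simp add: pencil_eigenfamily_def)
      finally have "l * (b i \<bullet> (W *v v)) = d i * (b i \<bullet> (W *v v))" .
      then have "d i = l \<or> b i \<bullet> (W *v v) = 0" by (metis mult_cancel_right)
      then show ?thesis using l by blast
    qed
    then have "v = 0" using pencil_eigenbasis_expansion[OF fam, of v] by simp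
    with that show False by simp
  qed
  moreover have "b i \<noteq> 0 \<and> S *v b i = d i *\<^sub>R (W *v b i)" for i
    using fam by (metis UNIV_I inner_zero_left pencil_eigenfamily_def zero_neq_one)
  ultimately show ?thesis unfolding eigenvalues_def iff by blast
qed

lemma max_eigenvalue_pencil:
  fixes W S :: "real^'n^'n"
  assumes fam: "pencil_eigenfamily W S UNIV b d" and "invertible W"
    and W: "transpose W = W" and S: "transpose S = S"
  shows "max_eigenvalue (matrix_inv W ** S) \<in> range d"
    and "d i \<le> max_eigenvalue (matrix_inv W ** S)"
    and "z \<bullet> (S *v z) \<le> max_eigenvalue (matrix_inv W ** S) * (z \<bullet> (W *v z))"
proof -
  have eq: "max_eigenvalue (matrix_inv W ** S) = Max (range d)"
    by (simp add: max_eigenvalue_def eigenvalues_pencil[OF assms])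
  then show "max_eigenvalue (matrix_inv W ** S) \<in> range d"
    using Max_in[of "range d"] by simp
  show le: "d i \<le> max_eigenvalue (matrix_inv W ** S)" for i by (simp add: eq)
  show "z \<bullet> (S *v z) \<le> max_eigenvalue (matrix_inv W ** S) * (z \<bullet> (W *v z))"
    unfolding pencil_eigenbasis_quadratic[OF fam W S] sum_distrib_left
    by (intro sum_mono mult_right_mono le) simp
qed

section \<open>Symmetric matrices and characteristic polynomials\<close>

lemma matrix_inv_mat_1: "matrix_inv (mat 1 :: real^'n^'n) = mat 1"
proof -
  have "invertible (mat 1 :: real^'n^'n)" unfolding invertible_def by (rule exI[of _ "mat 1"]) simp
  from matrix_inv_inverse(1)[OF this] show ?thesis by simp
qed

text \<open>The spectral theorem, obtained by extending the empty family with
  \<open>W = mat 1\<close>.\<close>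

lemma orthonormal_eigenbasis:
  fixes S :: "real^'n^'n"
  assumes "transpose S = S"
  obtains b d where "pencil_eigenfamily (mat 1) S UNIV b d"
  by (rule pencil_eigenfamily_extend[of "mat 1" S "{}" undefined undefined])
    (use assms in \<open>auto simp: transpose_mat pencil_eigenfamily_def\<close>)

lemma max_eigenvalue_symmetric:
  fixes S :: "real^'n^'n"
  assumes S: "transpose S = S"
  shows "\<exists>v. norm v = 1 \<and> v \<bullet> (S *v v) = max_eigenvalue S"
    and "z \<bullet> (S *v z) \<le> max_eigenvalue S * (norm z)\<^sup>2"
proof -
  obtain b d where fam: "pencil_eigenfamily (mat 1) S UNIV b d"
    using orthonormal_eigenbasis[OF S] .
  have inv: "invertible (mat 1 :: real^'n^'n)" unfolding invertible_def by (rule exI[of _ "mat 1"]) simp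
  note m = max_eigenvalue_pencil[OF fam inv transpose_mat S, unfolded matrix_inv_mat_1 matrix_mul_lid]
  obtain i where i: "max_eigenvalue S = d i" using m(1) by blast
  have "b i \<bullet> b i = 1" "S *v b i = d i *\<^sub>R b i"
    using fam by (auto simp: pencil_eigenfamily_def)
  then show "\<exists>v. norm v = 1 \<and> v \<bullet> (S *v v) = max_eigenvalue S"
    by (intro exI[of _ "b i"]) (simp add: i norm_eq_1)
  show "z \<bullet> (S *v z) \<le> max_eigenvalue S * (norm z)\<^sup>2"
    using m(3)[of z] by (simp add: dot_square_norm)
qed

text \<open>The columns of \<open>B\<close> are eigenvectors of \<open>A\<close>. Over polynomials
  this reads \<open>(X - A) B = B D\<close> with \<open>D\<close> the diagonal matrix of the linear
  factors, and the determinant of \<open>B\<close> cancels.\<close>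

lemma charpoly_eigenbasis:
  fixes A B L :: "real^'n^'n"
  assumes BL: "B ** L = mat 1" and AB: "\<And>i j. (A ** B) $ i $ j = d j * B $ i $ j"
  shows "charpoly A = (\<Prod>i\<in>UNIV. [:- d i, 1:])"
proof -
  let ?C = "map_matrix (\<lambda>c. [:c:]) :: real^'n^'n \<Rightarrow> _"
  define D :: "real poly^'n^'n" where "D = (\<chi> i j. if i = j then [:- d i, 1:] else 0)"
  have sum_const: "(\<Sum>k\<in>UNIV. [:f k:]) = [:\<Sum>k\<in>UNIV. f k:]" for f :: "'n \<Rightarrow> real"
    by (simp add: poly_eq_iff coeff_sum coeff_pCons split: nat.split)
  have "((mat [:0, 1:] - ?C A) ** ?C B) $ i $ j = (?C B ** D) $ i $ j" for i j
  proof -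
    have "((mat [:0, 1:] - ?C A) ** ?C B) $ i $ j
        = (\<Sum>k\<in>UNIV. (if i = k then [:0, 1:] * [:B $ k $ j:] else 0)) - (\<Sum>k\<in>UNIV. [:A $ i $ k * B $ k $ j:])"
      unfolding matrix_matrix_mult_def mat_def
      unfolding sum_subtractf[symmetric] by (auto intro!: sum.cong simp: left_diff_distrib)
    also have "\<dots> = [:0, 1:] * [:B $ i $ j:] - [:d j * B $ i $ j:]"
      using AB[of i j] by (simp add: sum_const matrix_matrix_mult_def)
    also have "\<dots> = [:B $ i $ j:] * [:- d j, 1:]" by simp
    also have "\<dots> = (\<Sum>k\<in>UNIV. if k = j then [:B $ i $ k:] * [:- d k, 1:] else 0)"
      by (subst sum.delta) simp_all
    also have "\<dots> = (?C B ** D) $ i $ j"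
      unfolding matrix_matrix_mult_def D_def by (auto simp del: sum.delta intro!: sum.cong)
    finally show ?thesis .
  qed
  then have "(mat [:0, 1:] - ?C A) ** ?C B = ?C B ** D" by (simp add: vec_eq_iff)
  then have "charpoly A * det (?C B) = det (?C B) * det D"
    unfolding charpoly_def det_mul[symmetric] by simp
  \<comment> \<open>The inverse \<open>L\<close> remains an inverse after embedding into polynomial
    matrices.\<close>
  moreover have "det (?C B) \<noteq> 0"
  proof -
    have "?C B ** ?C L = mat 1"
    proof -
      have "(?C B ** ?C L) $ i $ j = [:(B ** L) $ i $ j:]" for i j
        unfolding matrix_matrix_mult_def by (simp flip: sum_const add: mult.commute)
      then show ?thesis by (simp add: vec_eq_iff BL mat_def)
    qed
    from arg_cong[OF this, of det] show ?thesis by (auto simp: det_mul)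
  qed
  moreover have "det D = (\<Prod>i\<in>UNIV. [:- d i, 1:])"
    by (subst det_diagonal) (auto simp: D_def)
  ultimately show ?thesis by simp
qed

lemma charpoly_pencil:
  fixes W S :: "real^'n^'n"
  assumes fam: "pencil_eigenfamily W S UNIV b d" and "invertible W"
  shows "charpoly (matrix_inv W ** S) = (\<Prod>i\<in>UNIV. [:- d i, 1:])"
proof -
  obtain B L :: "real^'n^'n" where BL: "B ** L = mat 1" "\<And>i j. B $ i $ j = b j $ i"
    by (rule pencil_eigenbasis_matrix[OF fam]) blast
  have "(matrix_inv W ** S) *v b j = d j *\<^sub>R b j" for j
    using fam by (simp add: matrix_vector_mul_assoc[symmetric] matrix_inv_mult_vector_eq_iff
        assms(2) matrix_vector_mult_scaleR pencil_eigenfamily_def)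
  moreover have "((matrix_inv W ** S) ** B) $ i $ j = ((matrix_inv W ** S) *v b j) $ i" for i j
    by (simp add: matrix_matrix_mult_def[of _ B] matrix_vector_mult_def BL)
  ultimately show ?thesis by (intro charpoly_eigenbasis[OF BL(1)]) (simp add: BL)
qed

text \<open>Both families list the same multiset of roots. This transfers the measurement count from
  the given eigenvalues to those of any eigenbasis.\<close>

lemma sum_eq_of_prod_linear_eq:
  fixes d l :: "'n::finite \<Rightarrow> real" and f :: "real \<Rightarrow> 'b::comm_monoid_add"
  assumes "(\<Prod>i\<in>UNIV. [:- d i, 1:]) = (\<Prod>i\<in>UNIV. [:- l i, 1:])"
  shows "(\<Sum>i\<in>UNIV. f (d i)) = (\<Sum>i\<in>UNIV. f (l i))"
proof -
  have roots: "proots (\<Prod>i\<in>UNIV. [:- e i, 1:]) = image_mset e (mset_set UNIV)" for e :: "'n \<Rightarrow> real"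
    by (simp add: proots_prod sum_unfold_sum_mset)
  have "(\<Sum>i\<in>UNIV. f (e i)) = sum_mset (image_mset f (image_mset e (mset_set UNIV)))"
    for e :: "'n \<Rightarrow> real"
    by (simp add: sum_unfold_sum_mset image_mset.compositionality comp_def)
  then show ?thesis using arg_cong[OF assms, of proots] by (simp add: roots)
qed

section \<open>Characteristic functions of Gaussian vectors\<close>

text \<open>For \<open>s2 > 0\<close> the law is an affine image of the standard normal one; the
  point mass at \<open>s2 = 0\<close> obeys the same formula.\<close>

lemma char_normal_law:
  assumes "0 \<le> s2"
  shows "char (normal_law m s2) t = exp (\<i> * of_real (t * m)) * of_real (exp (- (t\<^sup>2 * s2) / 2))"
proof (cases "s2 = 0")
  case True
  then show ?thesis by (simp add: normal_law_def char_def integral_return mult.commute)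
next
  case False
  interpret N: prob_space std_normal_distribution by (rule prob_space_normal_density) simp
  have "distributed std_normal_distribution lborel (\<lambda>x. x) std_normal_density"
    by (auto simp: distributed_def distr_id2)
  from N.normal_density_affine[OF this, of "sqrt s2" m] False assms
  have "distr std_normal_distribution lborel (\<lambda>x. m + sqrt s2 * x) = density lborel (normal_density m (sqrt s2))"
    by (simp add: distributed_def)
  moreover have "distr std_normal_distribution lborel (\<lambda>x. m + sqrt s2 * x)
      = distr std_normal_distribution borel (\<lambda>x. m + sqrt s2 * x)"
    by (rule distr_cong) auto
  ultimately have eq: "normal_law m s2 = distr std_normal_distribution borel (\<lambda>x. m + sqrt s2 * x)"
    using False by (simp add: normal_law_def)
  have "char (normal_law m s2) t = (\<integral>x. iexp (t * m) * iexp (t * sqrt s2 * x) \<partial>std_normal_distribution)"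
    unfolding eq char_def
    by (subst integral_distr) (auto simp: exp_add[symmetric] algebra_simps)
  also have "\<dots> = iexp (t * m) * char std_normal_distribution (t * sqrt s2)"
    by (simp add: char_def)
  also have "\<dots> = iexp (t * m) * of_real (exp (- (t\<^sup>2 * s2) / 2))"
    using assms by (simp add: char_std_normal_distribution power_mult_distrib)
  finally show ?thesis by simp
qed

lemma char_gaussian_vector:
  assumes "gaussian_vector P X m S"
  shows "char (distr P borel (\<lambda>\<omega>. v \<bullet> (X \<omega> - m))) t = of_real (exp (- (t\<^sup>2 * (v \<bullet> (S *v v))) / 2))"
proof -
  have [measurable]: "X \<in> borel_measurable P" and pos: "0 \<le> v \<bullet> (S *v v)"
    and law: "distr P borel (\<lambda>\<omega>. v \<bullet> X \<omega>) = normal_law (v \<bullet> m) (v \<bullet> (S *v v))"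
    using assms by (auto simp: gaussian_vector_def covariance_matrix_def)
  have "char (distr P borel (\<lambda>\<omega>. v \<bullet> (X \<omega> - m))) t
      = (\<integral>\<omega>. iexp (- (t * (v \<bullet> m))) * iexp (t * (v \<bullet> X \<omega>)) \<partial>P)"
    unfolding char_def
    by (subst integral_distr) (auto simp: exp_add[symmetric] algebra_simps inner_diff_right)
  also have "\<dots> = iexp (- (t * (v \<bullet> m))) * char (distr P borel (\<lambda>\<omega>. v \<bullet> X \<omega>)) t"
    by (simp add: char_def integral_distr)
  also have "\<dots> = of_real (exp (- (t\<^sup>2 * (v \<bullet> (S *v v))) / 2))"
    unfolding law char_normal_law[OF pos] by (simp add: mult.assoc[symmetric] exp_add[symmetric])
  finally show ?thesis .
qed

text \<open>Independence turns the characteristic function of the sum into a product, in which the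
  exponents, hence the variances, add up.\<close>

lemma (in prob_space) char_gaussian_combination:
  fixes x :: "'a \<Rightarrow> real^'n" and w :: "nat \<Rightarrow> 'a \<Rightarrow> real^'n"
  assumes x: "gaussian_vector M x mu S"
    and w: "\<And>j. gaussian_vector M (w j) 0 Sw"
    and indep: "indep_vars (\<lambda>_. borel) (case_nat x w) UNIV"
  shows "char (distr M borel (\<lambda>\<omega>. b \<bullet> (x \<omega> - mu) + (\<Sum>j<m. c j \<bullet> w j \<omega>))) t
    = of_real (exp (- (t\<^sup>2 * (b \<bullet> (S *v b) + (\<Sum>j<m. c j \<bullet> (Sw *v c j)))) / 2))"
proof -
  \<comment> \<open>Index \<open>0\<close> stands for the signal and \<open>Suc j\<close> for the
    noise vector \<open>w j\<close>, as in \<open>case_nat x w\<close>.\<close>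
  define f where "f i v = (case i of 0 \<Rightarrow> b \<bullet> (v - mu) | Suc j \<Rightarrow> c j \<bullet> v)" for i :: nat and v
  define Y where "Y i = (\<lambda>\<omega>. f i (case_nat x w i \<omega>))" for i
  have f: "f i \<in> borel_measurable borel" for i
    unfolding f_def by (cases i) simp_all
  have "indep_vars (\<lambda>_. borel) Y UNIV"
    unfolding Y_def by (rule indep_vars_compose2[OF indep f])
  then have "indep_vars (\<lambda>_. borel) Y {..m}" by (rule indep_vars_subset) simp
  then have "char (distr M borel (\<lambda>\<omega>. \<Sum>i\<le>m. Y i \<omega>)) t = (\<Prod>i\<le>m. char (distr M borel (Y i)) t)"
    by (rule char_distr_sum)
  also have "(\<lambda>\<omega>. \<Sum>i\<le>m. Y i \<omega>) = (\<lambda>\<omega>. b \<bullet> (x \<omega> - mu) + (\<Sum>j<m. c j \<bullet> w j \<omega>))"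
    by (simp add: Y_def f_def sum.atMost_shift)
  also have "(\<Prod>i\<le>m. char (distr M borel (Y i)) t)
      = char (distr M borel (\<lambda>\<omega>. b \<bullet> (x \<omega> - mu))) t * (\<Prod>j<m. char (distr M borel (\<lambda>\<omega>. c j \<bullet> (w j \<omega> - 0))) t)"
    by (simp add: Y_def f_def prod.atMost_shift)
  also have "\<dots> = of_real (exp (- (t\<^sup>2 * (b \<bullet> (S *v b))) / 2) *
      (\<Prod>j<m. exp (- (t\<^sup>2 * (c j \<bullet> (Sw *v c j))) / 2)))"
    by (simp only: char_gaussian_vector[OF x] char_gaussian_vector[OF w] of_real_mult of_real_prod)
  also have "(\<Prod>j<m. exp (- (t\<^sup>2 * (c j \<bullet> (Sw *v c j))) / 2))
      = exp (- (t\<^sup>2 * (\<Sum>j<m. c j \<bullet> (Sw *v c j))) / 2)"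
    by (simp only: exp_sum[symmetric] finite_lessThan sum_distrib_left sum_negf[symmetric] sum_divide_distrib)
  also have "exp (- (t\<^sup>2 * (b \<bullet> (S *v b))) / 2) * exp (- (t\<^sup>2 * (\<Sum>j<m. c j \<bullet> (Sw *v c j))) / 2)
      = exp (- (t\<^sup>2 * (b \<bullet> (S *v b) + (\<Sum>j<m. c j \<bullet> (Sw *v c j)))) / 2)"
    by (simp add: exp_add[symmetric] field_simps)
  finally show ?thesis .
qed

section \<open>The squared length of a centred Gaussian vector\<close>

abbreviation std_normal_product :: "nat \<Rightarrow> (nat \<Rightarrow> real) measure" where
  "std_normal_product n \<equiv> PiM {..<n} (\<lambda>_. density lborel std_normal_density)"

lemma prob_space_std_normal_product: "prob_space (std_normal_product n)"
  by (intro prob_space_PiM prob_space_normal_density) simp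

lemma measurable_std_normal_product_component [measurable]:
  "i < n \<Longrightarrow> (\<lambda>z. z i) \<in> borel_measurable (std_normal_product n)"
  using measurable_component_singleton[of i "{..<n}" "\<lambda>_. density lborel std_normal_density"]
  by (simp cong: measurable_cong_sets)

text \<open>The characteristic function of a standard normal vector at \<open>c\<close>, by
  factorisation over the coordinates.\<close>

lemma integral_iexp_std_normal_product:
  "(\<integral>z. iexp (\<Sum>i<n. c i * z i) \<partial>std_normal_product n) = of_real (exp (- (\<Sum>i<n. (c i)\<^sup>2) / 2))"
proof -
  interpret N: prob_space std_normal_distribution by (rule prob_space_normal_density) simp
  interpret product_sigma_finite "\<lambda>_. std_normal_distribution" by standard
  have "(\<integral>z. iexp (\<Sum>i<n. c i * z i) \<partial>std_normal_product n)
      = (\<integral>z. (\<Prod>i<n. iexp (c i * z i)) \<partial>std_normal_product n)"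
    by (simp add: exp_sum sum_distrib_left)
  also have "\<dots> = (\<Prod>i<n. \<integral>z. iexp (c i * z) \<partial>std_normal_distribution)"
    by (rule product_integral_prod) (auto intro!: N.integrable_iexp)
  also have "\<dots> = (\<Prod>i<n. char std_normal_distribution (c i))" by (simp add: char_def)
  also have "\<dots> = of_real (exp (- (\<Sum>i<n. (c i)\<^sup>2) / 2))"
    by (simp add: char_std_normal_distribution exp_sum[symmetric] of_real_prod[symmetric] sum_negf
        sum_divide_distrib del: of_real_prod)
  finally show ?thesis .
qed

text \<open>\<open>exp (- s |e|\<^sup>2)\<close> is the characteristic function of a standard normal vector at
  \<open>sqrt (2 s) e\<close>, so by Fubini the Laplace transform of \<open>|e|\<^sup>2\<close> only depends on the laws of the
  linear functionals of \<open>e\<close>.\<close>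

lemma (in prob_space) laplace_transform_gaussian_norm:
  fixes e :: "'a \<Rightarrow> real^'n"
  assumes [measurable]: "e \<in> borel_measurable M"
    and char: "\<And>v. char (distr M borel (\<lambda>\<omega>. v \<bullet> e \<omega>)) 1 = of_real (exp (- (v \<bullet> (S *v v)) / 2))"
    and S_sym: "transpose S = S" and fam: "pencil_eigenfamily (mat 1) S UNIV b d"
    and h: "bij_betw h {..<CARD('n)} UNIV" and s: "0 \<le> s"
  shows "(\<integral>\<omega>. exp (- s * (norm (e \<omega>))\<^sup>2) \<partial>M)
    = (\<integral>z. exp (- s * (\<Sum>i<CARD('n). d (h i) * (z i)\<^sup>2)) \<partial>std_normal_product CARD('n))"
proof -
  let ?N = "std_normal_product CARD('n)"
  interpret N: prob_space ?N by (rule prob_space_std_normal_product)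
  interpret pair_prob_space M ?N ..
  \<comment> \<open>Chosen such that
    \<open>exp (- (r * y)\<^sup>2 / 2) = exp (- s * y\<^sup>2)\<close>.\<close>
  define r where "r = sqrt (2 * s)"
  have r: "r\<^sup>2 = 2 * s" using s by (simp add: r_def)
  have S: "S *v b i = d i *\<^sub>R b i" and ortho: "b i \<bullet> b j = (if i = j then 1 else 0)" for i j
    using fam by (auto simp: pencil_eigenfamily_def)
  \<comment> \<open>For standard normal \<open>z\<close> this is a normal vector with covariance
    \<open>2 * s\<close> times the identity, expressed in the eigenbasis of \<open>S\<close>;
    \<open>h\<close> numbers the basis by naturals to match
    \<open>std_normal_product\<close>.\<close>
  define V where "V z = (\<Sum>i<CARD('n). (r * z i) *\<^sub>R b (h i))" for z :: "nat \<Rightarrow> real"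
  have V_inner: "V z \<bullet> y = (\<Sum>i<CARD('n). (r * (b (h i) \<bullet> y)) * z i)" for z y
    by (simp add: V_def inner_sum_left mult_ac)
  have inj: "h i = h j \<longleftrightarrow> i = j" if "i < CARD('n)" "j < CARD('n)" for i j
    using h that by (auto simp: bij_betw_def inj_on_def)
  have V_quad: "V z \<bullet> (S *v V z) = 2 * s * (\<Sum>i<CARD('n). d (h i) * (z i)\<^sup>2)" for z
  proof -
    have SV: "S *v V z = (\<Sum>i<CARD('n). (r * z i * d (h i)) *\<^sub>R b (h i))"
      by (simp add: V_def linear_sum[OF matrix_vector_mul_linear] matrix_vector_mult_scaleR S)
    have "b (h i) \<bullet> (S *v V z) = r * z i * d (h i)" if "i < CARD('n)" for i
    proof -
      have "b (h i) \<bullet> (S *v V z) = (\<Sum>j<CARD('n). if i = j then r * z j * d (h j) else 0)"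
        unfolding SV inner_sum_right by (intro sum.cong) (use that inj in \<open>auto simp: ortho\<close>)
      also have "\<dots> = r * z i * d (h i)" using that by simp
      finally show ?thesis .
    qed
    then have "V z \<bullet> (S *v V z) = (\<Sum>i<CARD('n). r\<^sup>2 * (d (h i) * (z i)\<^sup>2))"
      unfolding V_inner by (intro sum.cong) (auto simp: power2_eq_square)
    then show ?thesis by (simp add: r sum_distrib_left)
  qed
  have norm_eq: "(norm y)\<^sup>2 = (\<Sum>i<CARD('n). (b (h i) \<bullet> y)\<^sup>2)" for y
    using pencil_eigenbasis_quadratic(1)[OF fam transpose_mat S_sym
, of y]
      sum.reindex_bij_betw[OF h, of "\<lambda>i. (b i \<bullet> y)\<^sup>2"] by (simp add: dot_square_norm)
  have "of_real (\<integral>\<omega>. exp (- s * (norm (e \<omega>))\<^sup>2) \<partial>M)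
      = (\<integral>\<omega>. complex_of_real (exp (- s * (norm (e \<omega>))\<^sup>2)) \<partial>M)" by simp
  also have "\<dots> = (\<integral>\<omega>. (\<integral>z. iexp (V z \<bullet> e \<omega>) \<partial>?N) \<partial>M)"
    unfolding V_inner integral_iexp_std_normal_product
    by (simp add: power_mult_distrib r norm_eq sum_distrib_left[symmetric])
  also have "\<dots> = (\<integral>z. (\<integral>\<omega>. iexp (V z \<bullet> e \<omega>) \<partial>M) \<partial>?N)"
  proof (rule Fubini_integral[symmetric])
    show "integrable (M \<Otimes>\<^sub>M ?N) (\<lambda>(\<omega>, z). iexp (V z \<bullet> e \<omega>))"
      unfolding V_inner split_beta
    proof (rule P.integrable_iexp)
      have z: "(\<lambda>p. snd p i) \<in> borel_measurable (M \<Otimes>\<^sub>M ?N)" if "i \<in> {..<CARD('n)}" for i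
        using measurable_compose[OF measurable_snd[of M] measurable_std_normal_product_component, of i] that
        by simp
      have y: "(\<lambda>p. b (h i) \<bullet> e (fst p)) \<in> borel_measurable (M \<Otimes>\<^sub>M ?N)" for i
        by (intro borel_measurable_inner borel_measurable_const measurable_compose[OF measurable_fst assms(1)])
      have "(\<lambda>p. \<Sum>i<CARD('n). (r * (b (h i) \<bullet> e (fst p))) * snd p i)
          \<in> borel_measurable (M \<Otimes>\<^sub>M ?N)"
        by (intro borel_measurable_sum borel_measurable_times borel_measurable_const y z)
      then show "(\<lambda>p. complex_of_real (\<Sum>i<CARD('n). (r * (b (h i) \<bullet> e (fst p))) * snd p i))
          \<in> borel_measurable (M \<Otimes>\<^sub>M ?N)" by (rule measurable_compose[OF _ borel_measurable_of_real])
    qed simp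
  qed
  also have "\<dots> = (\<integral>z. complex_of_real (exp (- s * (\<Sum>i<CARD('n). d (h i) * (z i)\<^sup>2))) \<partial>?N)"
  proof (rule Bochner_Integration.integral_cong[OF refl])
    fix z
    \<comment> \<open>For fixed \<open>z\<close> the inner integral is the characteristic function
      of \<open>e\<close> at \<open>V z\<close>, whose exponent is given by
      \<open>V_quad\<close>.\<close>
    have "(\<integral>\<omega>. iexp (V z \<bullet> e \<omega>) \<partial>M) = char (distr M borel (\<lambda>\<omega>. V z \<bullet> e \<omega>)) 1"
      by (simp add: char_def integral_distr)
    then show "(\<integral>\<omega>. iexp (V z \<bullet> e \<omega>) \<partial>M)
        = complex_of_real (exp (- s * (\<Sum>i<CARD('n). d (h i) * (z i)\<^sup>2)))"
      by (simp add: char V_quad)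
  qed
  also have "\<dots> = of_real (\<integral>z. exp (- s * (\<Sum>i<CARD('n). d (h i) * (z i)\<^sup>2)) \<partial>?N)" by simp
  finally show ?thesis by (simp only: of_real_eq_iff)
qed

text \<open>The Hausdorff moment problem on the unit interval is determinate, since the moments give the
  power series of the characteristic function.\<close>

lemma char_moments_sums:
  fixes M :: "'a measure" and U :: "'a \<Rightarrow> real"
  assumes "prob_space M" and [measurable]: "U \<in> borel_measurable M"
    and U: "\<And>\<omega>. 0 \<le> U \<omega>" "\<And>\<omega>. U \<omega> \<le> 1"
  shows "(\<lambda>k. (\<i> * of_real t) ^ k / of_real (fact k) * of_real (\<integral>\<omega>. U \<omega> ^ k \<partial>M))
    sums char (distr M borel U) t"
proof -
  interpret prob_space M by fact
  define f where "f k \<omega> = (\<i> * of_real t) ^ k / of_real (fact k) * of_real (U \<omega> ^ k)" for k \<omega>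
  \<comment> \<open>As \<open>U\<close> takes values in the unit interval, the terms are dominated
    by the exponential series in \<open>\<bar>t\<bar>\<close>, which permits integrating the series
    term by term.\<close>
  have norm_f: "norm (f k \<omega>) \<le> \<bar>t\<bar> ^ k / fact k" for k \<omega>
  proof -
    have "norm (f k \<omega>) = \<bar>t\<bar> ^ k / fact k * U \<omega> ^ k"
      using U by (simp add: f_def norm_mult norm_divide norm_power)
    also have "\<dots> \<le> \<bar>t\<bar> ^ k / fact k * 1"
      using U by (intro mult_left_mono power_le_one) auto
    finally show ?thesis by simp
  qed
  have summable: "summable (\<lambda>k. \<bar>t\<bar> ^ k / fact k)"
    using summable_exp[of "\<bar>t\<bar>"] by (simp add: field_simps)
  have meas: "f k \<in> borel_measurable M" for k
    unfolding f_def by (intro borel_measurable_times borel_measurable_const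
        measurable_compose[OF _ borel_measurable_of_real] borel_measurable_power) fact
  have int: "integrable M (f k)" for k
    by (rule integrable_const_bound[where B = "\<bar>t\<bar> ^ k / fact k"]) (use norm_f meas in auto)
  have "(\<lambda>k. integral\<^sup>L M (f k)) sums (\<integral>\<omega>. (\<Sum>k. f k \<omega>) \<partial>M)"
  proof (rule sums_integral[OF int])
    show "AE \<omega> in M. summable (\<lambda>k. norm (f k \<omega>))"
      using norm_f by (intro AE_I2 summable_comparison_test'[OF summable]) auto
    have "(\<integral>\<omega>. norm (f k \<omega>) \<partial>M) \<le> \<bar>t\<bar> ^ k / fact k" for k
      using integral_mono[OF integrable_norm[OF int] integrable_const, of k "\<bar>t\<bar> ^ k / fact k"] norm_f
      by (simp add: prob_space)
    then show "summable (\<lambda>k. \<integral>\<omega>. norm (f k \<omega>) \<partial>M)"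
      by (intro summable_comparison_test'[OF summable]) auto
  qed
  moreover have "f k \<omega> = (\<i> * of_real (t * U \<omega>)) ^ k /\<^sub>R fact k" for k \<omega>
    by (simp add: f_def scaleR_conv_of_real power_mult_distrib divide_inverse mult_ac)
  then have "(\<Sum>k. f k \<omega>) = iexp (t * U \<omega>)" for \<omega>
    by (simp only: exp_def)
  moreover have "integral\<^sup>L M (f k) = (\<i> * of_real t) ^ k / of_real (fact k) * of_real (\<integral>\<omega>. U \<omega> ^ k \<partial>M)" for k
    unfolding f_def by (simp only: integral_mult_right_zero integral_complex_of_real)
  ultimately show ?thesis by (simp add: char_def integral_distr)
qed

lemma distr_eqI_moments:
  fixes M :: "'a measure" and N :: "'b measure" and U :: "'a \<Rightarrow> real" and V :: "'b \<Rightarrow> real"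
  assumes "prob_space M" "prob_space N"
    and U: "U \<in> borel_measurable M" "\<And>\<omega>. 0 \<le> U \<omega>" "\<And>\<omega>. U \<omega> \<le> 1"
    and V: "V \<in> borel_measurable N" "\<And>z. 0 \<le> V z" "\<And>z. V z \<le> 1"
    and moments: "\<And>k. (\<integral>\<omega>. U \<omega> ^ k \<partial>M) = (\<integral>z. V z ^ k \<partial>N)"
  shows "distr M borel U = distr N borel V"
proof (rule Levy_uniqueness)
  show "real_distribution (distr M borel U)" "real_distribution (distr N borel V)"
    using assms by (auto intro: prob_space.real_distribution_distr)
  show "char (distr M borel U) = char (distr N borel V)"
  proof
    fix t
    from char_moments_sums[OF assms(1) U, of t] char_moments_sums[OF assms(2) V, of t]
    show "char (distr M borel U) t = char (distr N borel V) t"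
      unfolding moments by (rule sums_unique2)
  qed
qed

text \<open>Moment determinacy is applied to \<open>exp (- (norm e)\<^sup>2)\<close>, a variable in
  the unit interval whose moments are the values of the Laplace transform at the naturals.\<close>

lemma (in prob_space) prob_gaussian_norm_less:
  fixes e :: "'a \<Rightarrow> real^'n"
  assumes [measurable]: "e \<in> borel_measurable M"
    and char: "\<And>v. char (distr M borel (\<lambda>\<omega>. v \<bullet> e \<omega>)) 1 = of_real (exp (- (v \<bullet> (S *v v)) / 2))"
    and S_sym: "transpose S = S" and fam: "pencil_eigenfamily (mat 1) S UNIV b d"
    and h: "bij_betw h {..<CARD('n)} UNIV"
    and d: "\<And>i. 0 \<le> d i" and r: "0 < r"
  shows "prob {\<omega> \<in> space M. norm (e \<omega>) < r}
    = measure (std_normal_product CARD('n))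
        {z \<in> space (std_normal_product CARD('n)). (\<Sum>i<CARD('n). d (h i) * (z i)\<^sup>2) < r\<^sup>2}"
proof -
  let ?N = "std_normal_product CARD('n)"
  interpret N: prob_space ?N by (rule prob_space_std_normal_product)
  define T where "T z = (\<Sum>i<CARD('n). d (h i) * (z i)\<^sup>2)" for z :: "nat \<Rightarrow> real"
  have [measurable]: "T \<in> borel_measurable ?N" unfolding T_def
    by (intro borel_measurable_sum borel_measurable_times borel_measurable_power
        measurable_std_normal_product_component) auto
  have T: "0 \<le> T z" for z unfolding T_def using d by (intro sum_nonneg) auto
  let ?U = "\<lambda>\<omega>. exp (- (norm (e \<omega>))\<^sup>2)" and ?V = "\<lambda>z. exp (- T z)"
  have "distr M borel ?U = distr ?N borel ?V"
  proof (rule distr_eqI_moments)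
    fix k
    show "(\<integral>\<omega>. ?U \<omega> ^ k \<partial>M) = (\<integral>z. ?V z ^ k \<partial>?N)"
      using laplace_transform_gaussian_norm[OF assms(1) char S_sym fam h, of "real k"]
      by (simp add: exp_of_nat_mult[symmetric] T_def)
  qed (use T N.prob_space_axioms in \<open>auto intro: prob_space_axioms\<close>)
  \<comment> \<open>The ball is the event that this variable exceeds
    \<open>exp (- r\<^sup>2)\<close>.\<close>
  from arg_cong[OF this, of "\<lambda>D. measure D {exp (- r\<^sup>2)<..}"]
  have "prob (?U -` {exp (- r\<^sup>2)<..} \<inter> space M) = N.prob (?V -` {exp (- r\<^sup>2)<..} \<inter> space ?N)"
    by (subst (asm) (1 2) measure_distr) auto
  moreover have "?U -` {exp (- r\<^sup>2)<..} \<inter> space M = {\<omega> \<in> space M. norm (e \<omega>) < r}"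
    using r by (auto intro: power_strict_mono[OF _ norm_ge_zero pos2] power2_less_imp_less)
  moreover have "?V -` {exp (- r\<^sup>2)<..} \<inter> space ?N = {z \<in> space ?N. T z < r\<^sup>2}" by auto
  ultimately show ?thesis by (simp add: T_def)
qed

section \<open>The chi-squared quantile\<close>

lemma measurable_sum_squares [measurable]:
  "(\<lambda>z. \<Sum>i<n. (z i)\<^sup>2) \<in> borel_measurable (std_normal_product n)"
  by (intro borel_measurable_sum borel_measurable_power measurable_std_normal_product_component) auto

lemma real_distribution_chi_squared: "real_distribution (chi_squared n)"
  unfolding chi_squared_def
  by (intro prob_space.real_distribution_distr prob_space_std_normal_product measurable_sum_squares)

lemma measure_chi_squared:
  "A \<in> sets borel \<Longrightarrow> measure (chi_squared n) A
     = measure (std_normal_product n) {z \<in> space (std_normal_product n). (\<Sum>i<n. (z i)\<^sup>2) \<in> A}"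
  unfolding chi_squared_def by (subst measure_distr) (auto intro!: arg_cong2[where f = measure])

text \<open>With the other coordinates fixed, at most two values of the last one give the sum
  \<open>t\<close>; integrating over the others keeps this a null set.\<close>

lemma chi_squared_atomless:
  assumes "0 < n"
  shows "measure (chi_squared n) {t} = 0"
proof -
  obtain k where n: "n = Suc k" using assms gr0_conv_Suc by auto
  let ?M = "\<lambda>_::nat. density lborel std_normal_density"
  interpret N: prob_space std_normal_distribution by (rule prob_space_normal_density) simp
  interpret product_sigma_finite ?M by standard
  let ?A = "{z \<in> space (std_normal_product n). (\<Sum>i<n. (z i)\<^sup>2) \<in> {t}}"
  have [measurable]: "?A \<in> sets (std_normal_product n)" by measurable
  have ins: "{..<n} = insert k {..<k}" by (auto simp: n)
  have "emeasure (std_normal_product n) ?A = (\<integral>\<^sup>+z. indicator ?A z \<partial>std_normal_product n)" by simp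
  also have "\<dots> = (\<integral>\<^sup>+z. (\<integral>\<^sup>+y. indicator ?A (z(k := y)) \<partial>?M k) \<partial>std_normal_product k)"
    unfolding ins by (rule product_nn_integral_insert) (auto simp: ins[symmetric])
  also have "\<dots> = (\<integral>\<^sup>+z. 0 \<partial>std_normal_product k)"
  proof (intro nn_integral_cong)
    fix z
    \<comment> \<open>The value that the square of the last coordinate must take. If it is negative,
      no \<open>y\<close> qualifies and the claim below is vacuous.\<close>
    define c where "c = t - (\<Sum>i<k. (z i)\<^sup>2)"
    have "(\<integral>\<^sup>+y. indicator ?A (z(k := y)) \<partial>?M k) \<le> (\<integral>\<^sup>+y. indicator {sqrt c, - sqrt c} y \<partial>?M k)"
    proof (intro nn_integral_mono)
      fix y
      have "y = sqrt c \<or> y = - sqrt c" if "z(k := y) \<in> ?A"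
      proof -
        have "y\<^sup>2 = c" using that by (simp add: n c_def)
        then have "\<bar>y\<bar> = sqrt c" by (metis real_sqrt_abs)
        then show ?thesis by linarith
      qed
      then show "indicator ?A (z(k := y)) \<le> (indicator {sqrt c, - sqrt c} y :: ennreal)"
        by (auto simp: indicator_def)
    qed
    also have "\<dots> = emeasure (density lborel std_normal_density) {sqrt c, - sqrt c}"
      by (subst nn_integral_indicator) auto
    also have "\<dots> = (\<integral>\<^sup>+y. ennreal (std_normal_density y) * indicator {sqrt c, - sqrt c} y \<partial>lborel)"
      by (rule emeasure_density) auto
    also have "\<dots> = (\<integral>\<^sup>+(y::real). 0 \<partial>lborel)"
    proof (rule nn_integral_cong_AE)
      have "{sqrt c, - sqrt c} \<in> null_sets lborel"
        by (intro finite_imp_null_set_lborel) simp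
      then show "AE y in lborel. ennreal (std_normal_density y) * indicator {sqrt c, - sqrt c} y = 0"
        by (rule AE_I') (auto simp: indicator_def)
    qed
    finally show "(\<integral>\<^sup>+y. indicator ?A (z(k := y)) \<partial>?M k) = 0" by simp
  qed
  finally show ?thesis by (subst measure_chi_squared) (auto simp: measure_def)
qed

text \<open>The cdf vanishes up to \<open>0\<close>, there being no atom at \<open>0\<close>, and
  tends to \<open>1\<close>, so the infimum is taken over a nonempty set bounded below; by right
  continuity it is attained.\<close>

lemma
  assumes n: "0 < n" and p: "0 < p" "p < 1"
  shows chi_squared_quantile_pos: "0 < chi_squared_quantile n p"
    and cdf_chi_squared_quantile: "p \<le> cdf (chi_squared n) (chi_squared_quantile n p)"
proof -
  interpret real_distribution "chi_squared n" by (rule real_distribution_chi_squared)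
  let ?Q = "{t. p \<le> cdf (chi_squared n) t}" and ?q = "chi_squared_quantile n p"
  have nonpos: "cdf (chi_squared n) t = 0" if "t \<le> 0" for t
  proof -
    have "cdf (chi_squared n) t \<le> cdf (chi_squared n) 0" using that by (rule cdf_nondecreasing)
    also have "\<dots> = measure (chi_squared n) {0}"
      unfolding cdf_def by (simp add: measure_chi_squared order_antisym_conv sum_nonneg)
    also have "\<dots> = 0" using chi_squared_atomless[OF n] .
    finally show ?thesis using cdf_nonneg[of t] by linarith
  qed
  have ne: "?Q \<noteq> {}"
  proof -
    have "eventually (\<lambda>t. p < cdf (chi_squared n) t) at_top"
      using cdf_lim_at_top_prob p(2) by (rule order_tendstoD(1))
    then obtain t where "p < cdf (chi_squared n) t"
      unfolding eventually_at_top_linorder by blast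
    then show ?thesis by (auto intro: less_imp_le)
  qed
  have bdd: "bdd_below ?Q"
    using nonpos p by (intro bdd_belowI[of _ 0]) (smt (verit) mem_Collect_eq)
  \<comment> \<open>Points to the right of the infimum exceed some member of \<open>?Q\<close>, and
    the cdf is monotone; the bound then passes to the right limit.\<close>
  have "eventually (\<lambda>t. p \<le> cdf (chi_squared n) t) (at_right ?q)"
  proof (rule eventually_at_rightI[of _ "?q + 1"])
    fix t assume "t \<in> {?q<..<?q + 1}"
    then obtain s where "s \<in> ?Q" "s < t"
      using cInf_lessD[OF ne, of t] by (auto simp: chi_squared_quantile_def)
    then show "p \<le> cdf (chi_squared n) t" using cdf_nondecreasing[of s t] by simp
  qed simp
  moreover have "(cdf (chi_squared n) \<longlongrightarrow> cdf (chi_squared n) ?q) (at_right ?q)"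
    using cdf_is_right_cont[of ?q] by (simp add: continuous_within)
  ultimately show le: "p \<le> cdf (chi_squared n) ?q"
    by (intro tendsto_lowerbound[of "cdf (chi_squared n)"]) auto
  show "0 < ?q" using nonpos[of ?q] p(1) le by linarith
qed

text \<open>The inequality can be made strict because the law has no atoms; the strict error bound
  relies on this.\<close>

lemma prob_chi_squared_less_quantile:
  assumes n: "0 < n" and p: "0 < p" "p < 1"
  shows "p \<le> measure (std_normal_product n)
    {z \<in> space (std_normal_product n). (\<Sum>i<n. (z i)\<^sup>2) < chi_squared_quantile n p}"
proof -
  interpret real_distribution "chi_squared n" by (rule real_distribution_chi_squared)
  let ?q = "chi_squared_quantile n p"
  have "cdf (chi_squared n) ?q = measure (chi_squared n) ({..<?q} \<union> {?q})"
    unfolding cdf_def by (rule arg_cong[of _ _ "measure _"]) auto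
  also have "\<dots> = measure (chi_squared n) {..<?q} + measure (chi_squared n) {?q}"
    by (rule finite_measure_Union) auto
  also have "measure (chi_squared n) {?q} = 0" by (rule chi_squared_atomless[OF n])
  finally show ?thesis
    using cdf_chi_squared_quantile[OF n p] by (simp add: measure_chi_squared)
qed

text \<open>All eigenvalues of \<open>S\<close> are at most \<open>r\<^sup>2 / q\<close> for the
  quantile \<open>q\<close>, so a sum of squares below \<open>q\<close> forces the weighted sum
  below \<open>r\<^sup>2\<close>.\<close>

lemma (in prob_space) prob_gaussian_norm_ge:
  fixes e :: "'a \<Rightarrow> real^'n"
  assumes e: "e \<in> borel_measurable M"
    and char: "\<And>v. char (distr M borel (\<lambda>\<omega>. v \<bullet> e \<omega>)) 1 = of_real (exp (- (v \<bullet> (S *v v)) / 2))"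
    and cov: "covariance_matrix S"
    and p: "0 < p" "p < 1" and r: "0 < r"
    and S_le: "max_eigenvalue S \<le> r\<^sup>2 / chi_squared_quantile CARD('n) p"
  shows "p \<le> prob {\<omega> \<in> space M. norm (e \<omega>) < r}"
proof -
  let ?N = "std_normal_product CARD('n)" and ?q = "chi_squared_quantile CARD('n) p"
  interpret N: prob_space ?N by (rule prob_space_std_normal_product)
  have S_sym: "transpose S = S" using cov by (simp add: covariance_matrix_def)
  obtain b d where fam: "pencil_eigenfamily (mat 1) S UNIV b d"
    using orthonormal_eigenbasis[OF S_sym] .
  obtain h :: "nat \<Rightarrow> 'n" where h: "bij_betw h {..<CARD('n)} UNIV"
    using ex_bij_betw_nat_finite[of "UNIV :: 'n set"] by (auto simp: atLeast0LessThan)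
  have d: "0 \<le> d i" for i
    using pencil_eigenbasis_nonneg[OF fam] cov by (simp add: covariance_matrix_def)
  have q: "0 < ?q" using p by (intro chi_squared_quantile_pos) auto
  have d_le: "d i \<le> r\<^sup>2 / ?q" for i
  proof -
    have "S *v b i = d i *\<^sub>R b i" "b i \<bullet> b i = 1"
      using fam by (auto simp: pencil_eigenfamily_def)
    then have "d i \<le> max_eigenvalue S"
      using max_eigenvalue_symmetric(2)[OF S_sym, of "b i"] by (simp add: dot_square_norm)
    with S_le show ?thesis by simp
  qed
  have "p \<le> N.prob {z \<in> space ?N. (\<Sum>i<CARD('n). (z i)\<^sup>2) < ?q}"
    using p by (intro prob_chi_squared_less_quantile) auto
  also have "\<dots> \<le> N.prob {z \<in> space ?N. (\<Sum>i<CARD('n). d (h i) * (z i)\<^sup>2) < r\<^sup>2}"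
  proof (rule N.finite_measure_mono)
    show "{z \<in> space ?N. (\<Sum>i<CARD('n). (z i)\<^sup>2) < ?q}
        \<subseteq> {z \<in> space ?N. (\<Sum>i<CARD('n). d (h i) * (z i)\<^sup>2) < r\<^sup>2}"
    proof safe
      fix z assume z: "(\<Sum>i<CARD('n). (z i)\<^sup>2) < ?q"
      have "(\<Sum>i<CARD('n). d (h i) * (z i)\<^sup>2) \<le> (\<Sum>i<CARD('n). r\<^sup>2 / ?q * (z i)\<^sup>2)"
        by (intro sum_mono mult_right_mono d_le) simp
      also have "\<dots> = r\<^sup>2 / ?q * (\<Sum>i<CARD('n). (z i)\<^sup>2)" by (simp add: sum_distrib_left)
      also have "\<dots> < r\<^sup>2 / ?q * ?q" using z r q by (intro mult_strict_left_mono) auto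
      finally show "(\<Sum>i<CARD('n). d (h i) * (z i)\<^sup>2) < r\<^sup>2" using q by simp
    qed
    have "(\<lambda>z. \<Sum>i<CARD('n). d (h i) * (z i)\<^sup>2) \<in> borel_measurable ?N"
      by (intro borel_measurable_sum borel_measurable_times borel_measurable_power
          measurable_std_normal_product_component) auto
    then show "{z \<in> space ?N. (\<Sum>i<CARD('n). d (h i) * (z i)\<^sup>2) < r\<^sup>2} \<in> sets ?N" by measurable
  qed
  also have "\<dots> = prob {\<omega> \<in> space M. norm (e \<omega>) < r}"
    using prob_gaussian_norm_less[OF e char S_sym fam h d r] by simp
  finally show ?thesis .
qed

section \<open>The run of the algorithm\<close>

lemma columnvector_rowvector_nth:
  "(columnvector x ** (rowvector y :: real^'n^1)) $ i $ j = x $ i * y $ j"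
  for x :: "real^'m"
  by (simp add: matrix_matrix_mult_def columnvector_def rowvector_def)

lemma columnvector_rowvector_mult:
  "(columnvector x ** (rowvector y :: real^'n^1)) *v z = (y \<bullet> z) *\<^sub>R x" for x :: "real^'m"
  by (simp add: vec_eq_iff matrix_vector_mult_def columnvector_rowvector_nth inner_vec_def
      sum_distrib_left sum_distrib_right mult_ac)

locale info_greedy_sensing =
  fixes pick :: "real^'n^'n \<Rightarrow> real^'n" and eps p :: real and Sw :: "real^'n^'n"
  assumes Sw: "covariance_matrix Sw" and Sw_inv: "invertible Sw"
    and pick: "top_eigenvector_rule pick"
    and eps: "0 < eps" and p: "0 < p" "p < 1"
begin

text \<open>Depends on the eigenvalue alone, so the claimed bound is the sum of
  \<open>repeats\<close> over all eigenvalues: \<open>nat\<close> acts as the maximum with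
  \<open>0\<close>, and the eigenvalue \<open>0\<close> is charged nothing.\<close>

definition repeats :: "real \<Rightarrow> nat" where
  "repeats l = (if l = 0 then 0
     else nat \<lceil>chi_squared_quantile CARD('n) p / eps\<^sup>2 * max_eigenvalue Sw - 1 / l\<rceil>)"

text \<open>From here on one step is split into its parts. Only \<open>response\<close> and
  \<open>posterior_mean\<close> involve measured data; the others are functions of the
  covariance.\<close>

definition top_eig :: "real^'n^'n \<Rightarrow> real" where
  "top_eig S = max_eigenvalue (matrix_inv Sw ** S)"

definition dir :: "real^'n^'n \<Rightarrow> real^'n" where
  "dir S = pick (matrix_inv Sw ** S)"

definition sensing :: "real^'n^'n \<Rightarrow> real^'n" where
  "sensing S = sqrt (real (repeats (top_eig S))) *\<^sub>R dir S"

definition gain :: "real^'n^'n \<Rightarrow> real" where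
  "gain S = inverse (sensing S \<bullet> (S *v sensing S) + dir S \<bullet> (Sw *v dir S))"

definition response :: "(nat \<Rightarrow> real^'n \<Rightarrow> real) \<Rightarrow> real^'n^'n \<Rightarrow> nat \<Rightarrow> real" where
  "response sense S m =
     (\<Sum>j = m..<m + repeats (top_eig S). sense j (dir S)) / sqrt (real (repeats (top_eig S)))"

definition posterior_mean ::
    "(nat \<Rightarrow> real^'n \<Rightarrow> real) \<Rightarrow> real^'n^'n \<Rightarrow> nat \<Rightarrow> real^'n \<Rightarrow> real^'n" where
  "posterior_mean sense S m mu =
     mu + (gain S * (response sense S m - sensing S \<bullet> mu)) *\<^sub>R (S *v sensing S)"

definition posterior_cov :: "real^'n^'n \<Rightarrow> real^'n^'n" where
  "posterior_cov S = S - gain S *\<^sub>R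
     (columnvector (S *v sensing S) ** (rowvector (sensing S v* S) :: real^'n^1))"

lemma info_greedy_step_eq:
  "info_greedy_step pick eps p Sw sense (mu, S, m)
     = (posterior_mean sense S m mu, posterior_cov S, m + repeats (top_eig S))"
  unfolding info_greedy_step_def posterior_mean_def posterior_cov_def response_def gain_def
    sensing_def dir_def top_eig_def repeats_def Let_def by simp

lemma Sw_sym: "transpose Sw = Sw"
  using Sw by (simp add: covariance_matrix_def)

lemma Sw_pos: "v \<noteq> 0 \<Longrightarrow> 0 < v \<bullet> (Sw *v v)"
  by (rule covariance_matrix_invertible_pos[OF Sw Sw_inv])

lemma quantile_pos: "0 < chi_squared_quantile CARD('n) p"
  using p by (intro chi_squared_quantile_pos) auto

text \<open>\<open>pick\<close> is constrained only on matrices having a real eigenvalue; the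
  eigenbasis supplies one.\<close>

lemma top_eigenpair:
  assumes S: "transpose S = S"
  shows "norm (dir S) = 1" "S *v dir S = top_eig S *\<^sub>R (Sw *v dir S)"
proof -
  have "pencil_eigenfamily Sw S {} undefined undefined" by (simp add: pencil_eigenfamily_def)
  then obtain b d where fam: "pencil_eigenfamily Sw S UNIV b d"
    using pencil_eigenfamily_extend[OF Sw_sym Sw_pos S] by metis
  have "eigenvalues (matrix_inv Sw ** S) \<noteq> {}"
    by (simp add: eigenvalues_pencil[OF fam Sw_inv Sw_sym S])
  then have "norm (dir S) = 1 \<and> (matrix_inv Sw ** S) *v dir S = top_eig S *\<^sub>R dir S"
    using pick unfolding top_eigenvector_rule_def dir_def top_eig_def by blast
  then show "norm (dir S) = 1" "S *v dir S = top_eig S *\<^sub>R (Sw *v dir S)"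
    by (simp_all add: matrix_vector_mul_assoc[symmetric] matrix_inv_mult_vector_eq_iff[OF Sw_inv]
        matrix_vector_mult_scaleR)
qed

lemma dir_noise_pos:
  assumes "transpose S = S"
  shows "0 < dir S \<bullet> (Sw *v dir S)"
  using top_eigenpair(1)[OF assms] by (intro Sw_pos) auto

text \<open>The measured direction, rescaled to unit length for \<open>Sw\<close>, is a one-element
  family and can be extended to a basis.\<close>

lemma eigenbasis_of_top_eig:
  assumes S: "transpose S = S"
  obtains b d i where "pencil_eigenfamily Sw S UNIV b d" "d i = top_eig S"
    "dir S = sqrt (dir S \<bullet> (Sw *v dir S)) *\<^sub>R b i"
proof -
  let ?r = "sqrt (dir S \<bullet> (Sw *v dir S))"
  \<comment> \<open>Any index may carry this vector; \<open>undefined\<close> merely names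
    one.\<close>
  define i :: 'n where "i = undefined"
  have r: "0 < ?r" "?r * ?r = dir S \<bullet> (Sw *v dir S)" using dir_noise_pos[OF S] by auto
  have "pencil_eigenfamily Sw S {i} (\<lambda>_. dir S /\<^sub>R ?r) (\<lambda>_. top_eig S)"
    using r dir_noise_pos[OF S] top_eigenpair(2)[OF S]
    by (simp add: pencil_eigenfamily_def matrix_vector_mult_scaleR field_simps)
  then obtain b d where "pencil_eigenfamily Sw S UNIV b d" "b i = dir S /\<^sub>R ?r" "d i = top_eig S"
    using pencil_eigenfamily_extend[OF Sw_sym Sw_pos S] by (metis singletonI)
  then show thesis using r(1) by (intro that[of b d i]) auto
qed

lemma top_eig_nonneg:
  assumes "covariance_matrix S"
  shows "0 \<le> top_eig S"
proof -
  have S: "transpose S = S" "\<And>v. 0 \<le> v \<bullet> (S *v v)"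
    using assms by (auto simp: covariance_matrix_def)
  obtain b d i where "pencil_eigenfamily Sw S UNIV b d" "d i = top_eig S"
    using eigenbasis_of_top_eig[OF S(1)] by metis
  then show ?thesis using pencil_eigenbasis_nonneg S(2) by metis
qed

section \<open>Effect of a step on the covariance\<close>

lemma posterior_cov_mult:
  assumes "transpose S = S"
  shows "posterior_cov S *v z
    = S *v z - (gain S * (sensing S \<bullet> (S *v z))) *\<^sub>R (S *v sensing S)"
  by (simp add: posterior_cov_def matrix_vector_mult_diff_rdistrib dot_lmul_matrix
      scaleR_matrix_vector_assoc[symmetric] columnvector_rowvector_mult)

lemma posterior_cov_sym:
  assumes "transpose S = S"
  shows "transpose (posterior_cov S) = posterior_cov S"
proof -
  have "sensing S v* S = S *v sensing S"
    using assms by (metis vector_transpose_matrix)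
  then show ?thesis using assms
    by (simp add: posterior_cov_def vec_eq_iff transpose_def columnvector_rowvector_nth mult.commute)
qed

lemma gain_eq:
  assumes S: "covariance_matrix S"
  shows "gain S * (sensing S \<bullet> (S *v sensing S) + dir S \<bullet> (Sw *v dir S)) = 1"
proof -
  have "0 < sensing S \<bullet> (S *v sensing S) + dir S \<bullet> (Sw *v dir S)"
    using S dir_noise_pos by (intro add_nonneg_pos) (auto simp: covariance_matrix_def)
  then show ?thesis by (simp add: gain_def)
qed

lemma posterior_cov_quadratic:
  assumes S: "covariance_matrix S"
  shows "v \<bullet> (posterior_cov S *v v) = v \<bullet> (S *v v) - gain S * (sensing S \<bullet> (S *v v))\<^sup>2"
  using S symmetric_matrix_inner[of S v "sensing S"]
  by (simp add: posterior_cov_mult covariance_matrix_def inner_diff_right power2_eq_square)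

text \<open>\<open>S *v sensing S\<close> is a multiple of \<open>Sw *v b i\<close>, so the rank-one
  correction vanishes on every other \<open>b j\<close>. On \<open>b i\<close> it turns the
  eigenvalue \<open>l\<close> into \<open>1 / (k + 1 / l)\<close>, written here in a form that also
  covers \<open>l = 0\<close>.\<close>

lemma posterior_cov_eigenfamily:
  assumes S: "covariance_matrix S"
    and fam: "pencil_eigenfamily Sw S UNIV b d" and i: "d i = top_eig S"
    and dir: "dir S = sqrt (dir S \<bullet> (Sw *v dir S)) *\<^sub>R b i"
  shows "pencil_eigenfamily Sw (posterior_cov S) UNIV b
    (d(i := top_eig S / (real (repeats (top_eig S)) * top_eig S + 1)))"
proof -
  have sym: "transpose S = S" using S by (simp add: covariance_matrix_def)
  define r where "r = sqrt (dir S \<bullet> (Sw *v dir S))"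
  define k where "k = real (repeats (top_eig S))"
  have r: "0 < r" "dir S \<bullet> (Sw *v dir S) = r\<^sup>2" using dir_noise_pos[OF sym] by (auto simp: r_def)
  have Sb: "S *v b j = d j *\<^sub>R (Sw *v b j)"
    and ortho: "b j \<bullet> (Sw *v b l) = (if j = l then 1 else 0)" for j l
    using fam by (auto simp: pencil_eigenfamily_def)
  have a: "sensing S = (sqrt k * r) *\<^sub>R b i"
    unfolding sensing_def by (subst dir) (simp add: r_def k_def)
  have k: "0 \<le> k" "sqrt k * sqrt k = k" by (simp_all add: k_def)
  have Sa: "S *v sensing S = (sqrt k * r * top_eig S) *\<^sub>R (Sw *v b i)"
    by (simp add: a matrix_vector_mult_scaleR Sb i)
  have aSa: "sensing S \<bullet> (S *v sensing S) = k * r\<^sup>2 * top_eig S"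
  proof -
    have "sensing S \<bullet> (S *v sensing S) = (sqrt k * sqrt k) * r\<^sup>2 * top_eig S"
      unfolding Sa by (simp add: a ortho power2_eq_square del: real_sqrt_mult_self)
    then show ?thesis by (simp only: k(2))
  qed
  have pos: "0 < k * top_eig S + 1" using k(1) top_eig_nonneg[OF S] by (intro add_nonneg_pos) auto
  \<comment> \<open>The Euclidean unit direction has \<open>Sw\<close>-length \<open>r\<close>; the
    gain compensates for this factor, so the new eigenvalue does not depend on
    \<open>r\<close>.\<close>
  have gain: "gain S * r\<^sup>2 = 1 / (k * top_eig S + 1)"
    using gain_eq[OF S] pos unfolding aSa r(2) by (simp add: field_simps)
  have "posterior_cov S *v b j = (d(i := top_eig S / (k * top_eig S + 1))) j *\<^sub>R (Sw *v b j)" for j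
  proof (cases "j = i")
    case False
    then show ?thesis by (simp add: posterior_cov_mult[OF sym] Sb a ortho)
  next
    case True
    have "posterior_cov S *v b i
        = top_eig S *\<^sub>R (Sw *v b i) - (gain S * (sqrt k * r * top_eig S)) *\<^sub>R ((sqrt k * r * top_eig S) *\<^sub>R (Sw *v b i))"
      unfolding posterior_cov_mult[OF sym] Sa by (simp add: a Sb i ortho)
    also have "\<dots> = (top_eig S - (gain S * r\<^sup>2) * (sqrt k * sqrt k) * (top_eig S)\<^sup>2) *\<^sub>R (Sw *v b i)"
      by (simp add: scaleR_diff_left power2_eq_square mult_ac)
    also have "top_eig S - (gain S * r\<^sup>2) * (sqrt k * sqrt k) * (top_eig S)\<^sup>2 = top_eig S / (k * top_eig S + 1)"
      unfolding gain k(2) using pos by (simp add: field_simps power2_eq_square)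
    finally show ?thesis using True by simp
  qed
  then show ?thesis using ortho by (simp add: pencil_eigenfamily_def k_def)
qed

text \<open>In the common eigenbasis all eigenvalues remain nonnegative.\<close>

lemma posterior_cov_covariance:
  assumes S: "covariance_matrix S"
  shows "covariance_matrix (posterior_cov S)"
proof -
  have sym: "transpose S = S" and psd: "\<And>v. 0 \<le> v \<bullet> (S *v v)"
    using S by (auto simp: covariance_matrix_def)
  obtain b d i where bdi: "pencil_eigenfamily Sw S UNIV b d" "d i = top_eig S"
    "dir S = sqrt (dir S \<bullet> (Sw *v dir S)) *\<^sub>R b i"
    using eigenbasis_of_top_eig[OF sym] .
  have "0 \<le> d j" for j using pencil_eigenbasis_nonneg[OF bdi(1) psd] .
  then have "0 \<le> v \<bullet> (posterior_cov S *v v)" for v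
    unfolding pencil_eigenbasis_quadratic(2)[OF posterior_cov_eigenfamily[OF S bdi] Sw_sym
        posterior_cov_sym[OF sym]]
    using top_eig_nonneg[OF S] by (intro sum_nonneg) auto
  then show ?thesis by (simp add: covariance_matrix_def posterior_cov_sym[OF sym])
qed

text \<open>The reciprocal of the reduced eigenvalue is \<open>k + 1 / l\<close>, and rounding up
  made \<open>k\<close> at least the required amount \<open>?C - 1 / l\<close>.\<close>

lemma repeats_reduced:
  assumes "0 \<le> l"
  shows "repeats (l / (real (repeats l) * l + 1)) = 0"
proof (cases "l = 0")
  case False
  let ?C = "chi_squared_quantile CARD('n) p / eps\<^sup>2 * max_eigenvalue Sw"
  define k where "k = real (repeats l)"
  have "?C - 1 / l \<le> k" unfolding k_def using False by (simp add: repeats_def) linarith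
  moreover have "1 / (l / (k * l + 1)) = k + 1 / l" using False by (simp add: field_simps)
  ultimately have "\<lceil>?C - 1 / (l / (k * l + 1))\<rceil> \<le> 0" by linarith
  then have "repeats (l / (k * l + 1)) = 0" unfolding repeats_def by simp
  then show ?thesis by (simp add: k_def)
qed (simp add: repeats_def)

text \<open>The sum of \<open>repeats\<close> over the eigenvalues is a potential: a step changes
  one eigenvalue, whose charge falls to \<open>0\<close>, and spends exactly that charge. Counting
  through the characteristic polynomial respects multiplicities and allows a new eigenbasis in each
  step.\<close>

lemma charpoly_posterior_cov:
  fixes l :: "'n \<Rightarrow> real"
  assumes S: "covariance_matrix S"
    and l: "charpoly (matrix_inv Sw ** S) = (\<Prod>i\<in>UNIV. [:- l i, 1:])"
  obtains l' :: "'n \<Rightarrow> real" where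
    "charpoly (matrix_inv Sw ** posterior_cov S) = (\<Prod>i\<in>UNIV. [:- l' i, 1:])"
    "repeats (top_eig S) + (\<Sum>i\<in>UNIV. repeats (l' i)) = (\<Sum>i\<in>UNIV. repeats (l i))"
proof -
  have sym: "transpose S = S" using S by (simp add: covariance_matrix_def)
  obtain b d i where bdi: "pencil_eigenfamily Sw S UNIV b d" "d i = top_eig S"
    "dir S = sqrt (dir S \<bullet> (Sw *v dir S)) *\<^sub>R b i"
    using eigenbasis_of_top_eig[OF sym] .
  let ?d' = "d(i := top_eig S / (real (repeats (top_eig S)) * top_eig S + 1))"
  \<comment> \<open>Passes from the given list of eigenvalues to the eigenbasis that contains the
    measured direction.\<close>
  have "(\<Sum>j\<in>UNIV. repeats (l j)) = (\<Sum>j\<in>UNIV. repeats (d j))"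
    by (rule sum_eq_of_prod_linear_eq) (simp only: l[symmetric] charpoly_pencil[OF bdi(1) Sw_inv, symmetric])
  also have "\<dots> = repeats (top_eig S) + (\<Sum>j\<in>UNIV - {i}. repeats (d j))"
    by (simp add: sum.remove[of UNIV i] bdi(2))
  also have "(\<Sum>j\<in>UNIV - {i}. repeats (d j)) = (\<Sum>j\<in>UNIV - {i}. repeats (?d' j))"
    by (rule sum.cong) auto
  also have "\<dots> = (\<Sum>j\<in>UNIV. repeats (?d' j))"
    using repeats_reduced[OF top_eig_nonneg[OF S]] by (simp add: sum.remove[of UNIV i])
  finally have "repeats (top_eig S) + (\<Sum>j\<in>UNIV. repeats (?d' j)) = (\<Sum>j\<in>UNIV. repeats (l j))"
    by (rule HOL.sym)
  with charpoly_pencil[OF posterior_cov_eigenfamily[OF S bdi] Sw_inv] show thesis by (rule that)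
qed

text \<open>Compares the forms of \<open>S\<close> and \<open>Sw\<close> at a unit vector where the
  former is largest.\<close>

lemma repeats_0_imp_stop:
  assumes S: "covariance_matrix S" and 0: "repeats (top_eig S) = 0"
  shows "max_eigenvalue S \<le> eps\<^sup>2 / chi_squared_quantile CARD('n) p"
proof -
  let ?q = "chi_squared_quantile CARD('n) p"
  have sym: "transpose S = S" using S by (simp add: covariance_matrix_def)
  obtain b d i where fam: "pencil_eigenfamily Sw S UNIV b d"
    using eigenbasis_of_top_eig[OF sym] by metis
  obtain v where v: "norm v = 1" "v \<bullet> (S *v v) = max_eigenvalue S"
    using max_eigenvalue_symmetric(1)[OF sym] by blast
  have "max_eigenvalue S \<le> top_eig S * (v \<bullet> (Sw *v v))"
    using max_eigenvalue_pencil(3)[OF fam Sw_inv Sw_sym sym, of v] v by (simp add: top_eig_def)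
  also have "\<dots> \<le> top_eig S * max_eigenvalue Sw"
    using max_eigenvalue_symmetric(2)[OF Sw_sym, of v] v top_eig_nonneg[OF S]
    by (intro mult_left_mono) auto
  also have "\<dots> \<le> eps\<^sup>2 / ?q"
  \<comment> \<open>For nonzero \<open>top_eig S\<close> the nonpositive ceiling is the claim after
    clearing denominators; otherwise the left side is \<open>0\<close>.\<close>
  proof (cases "top_eig S = 0")
    case False
    then have pos: "0 < top_eig S" using top_eig_nonneg[OF S] by simp
    have "?q / eps\<^sup>2 * max_eigenvalue Sw \<le> 1 / top_eig S"
      using 0 False by (simp add: repeats_def)
    then show ?thesis using pos quantile_pos eps by (simp add: field_simps)
  qed (use quantile_pos in auto)
  finally show ?thesis .
qed

text \<open>The error of the estimate is a linear image of the signal and of the noise vectors used so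
  far, and \<open>S\<close> is its covariance.\<close>

definition error_cov ::
    "('a \<Rightarrow> real^'n) \<Rightarrow> (nat \<Rightarrow> 'a \<Rightarrow> real^'n) \<Rightarrow> real^'n \<Rightarrow> real^'n^'n \<Rightarrow>
     ('a \<Rightarrow> real^'n) \<Rightarrow> real^'n^'n \<Rightarrow> nat \<Rightarrow> bool" where
  "error_cov x w mu S0 F S m \<longleftrightarrow> (\<forall>v. \<exists>b c.
     (\<forall>\<omega>. v \<bullet> (x \<omega> - F \<omega>) = b \<bullet> (x \<omega> - mu) + (\<Sum>j<m. c j \<bullet> w j \<omega>)) \<and>
     v \<bullet> (S *v v) = b \<bullet> (S0 *v b) + (\<Sum>j<m. c j \<bullet> (Sw *v c j)))"

text \<open>A functional \<open>v\<close> of the new error is the functional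
  \<open>v' = v - \<alpha> a\<close> of the old error minus \<open>\<alpha>\<close> times the
  combined noise. That noise has the fresh indices \<open>m..<m + k\<close>, so its coefficients are
  appended. For the covariance this is the Joseph form of the Kalman update.\<close>

lemma error_cov_step:
  assumes S: "covariance_matrix S" and err: "error_cov x w mu S0 F S m"
  shows "error_cov x w mu S0
    (\<lambda>\<omega>. posterior_mean (\<lambda>j u. u \<bullet> (x \<omega> + w j \<omega>)) S m (F \<omega>)) (posterior_cov S)
    (m + repeats (top_eig S))"
  unfolding error_cov_def
proof
  fix v
  have sym: "transpose S = S" using S by (simp add: covariance_matrix_def)
  define k where "k = repeats (top_eig S)"
  define \<beta> where "\<beta> = sensing S \<bullet> (S *v v)"
  define \<alpha> where "\<alpha> = gain S * \<beta>"
  define v' where "v' = v - \<alpha> *\<^sub>R sensing S"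
  obtain b c where bc: "\<And>\<omega>. v' \<bullet> (x \<omega> - F \<omega>) = b \<bullet> (x \<omega> - mu) + (\<Sum>j<m. c j \<bullet> w j \<omega>)"
    "v' \<bullet> (S *v v') = b \<bullet> (S0 *v b) + (\<Sum>j<m. c j \<bullet> (Sw *v c j))"
    using spec[OF err[unfolded error_cov_def], of v'] by auto
  \<comment> \<open>Each of the \<open>k\<close> responses enters with weight
    \<open>1 / sqrt k\<close>, so \<open>\<alpha>\<close> is spread equally, with
    \<open>k * \<gamma>\<^sup>2 = \<alpha>\<^sup>2\<close> for \<open>k > 0\<close>.\<close>
  define \<gamma> where "\<gamma> = - \<alpha> / sqrt (real k)"
  define c' where "c' j = (if j < m then c j else \<gamma> *\<^sub>R dir S)" for j
  have \<beta>: "v \<bullet> (S *v sensing S) = \<beta>"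
    unfolding \<beta>_def by (rule symmetric_matrix_inner[OF sym])
  have a: "sensing S = sqrt (real k) *\<^sub>R dir S" by (simp add: sensing_def k_def)
  have sum_split: "(\<Sum>j<m + k. f j) = (\<Sum>j<m. f j) + (\<Sum>j = m..<m + k. f j)" for f :: "nat \<Rightarrow> real"
    using sum.atLeastLessThan_concat[of 0 m "m + k" f] by (simp add: atLeast0LessThan)
  have mean: "v \<bullet> (x \<omega> - posterior_mean (\<lambda>j u. u \<bullet> (x \<omega> + w j \<omega>)) S m (F \<omega>))
      = b \<bullet> (x \<omega> - mu) + (\<Sum>j<m + k. c' j \<bullet> w j \<omega>)" for \<omega>
  proof -
    define \<nu> where "\<nu> = (\<Sum>j = m..<m + k. dir S \<bullet> w j \<omega>) / sqrt (real k)"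
    have "response (\<lambda>j u. u \<bullet> (x \<omega> + w j \<omega>)) S m = (real k * (dir S \<bullet> x \<omega>)) / sqrt (real k) + \<nu>"
      by (simp add: response_def k_def[symmetric] \<nu>_def inner_add_right sum.distrib add_divide_distrib)
    \<comment> \<open>\<open>k / sqrt k = sqrt k\<close> holds also for \<open>k = 0\<close>, both
      sides being \<open>0\<close>.\<close>
    also have "(real k * (dir S \<bullet> x \<omega>)) / sqrt (real k) = sensing S \<bullet> x \<omega>"
      by (simp only: a inner_scaleR_left times_divide_eq_left[symmetric] real_div_sqrt of_nat_0_le_iff)
    finally have "v \<bullet> (x \<omega> - posterior_mean (\<lambda>j u. u \<bullet> (x \<omega> + w j \<omega>)) S m (F \<omega>))
        = v' \<bullet> (x \<omega> - F \<omega>) - \<alpha> * \<nu>"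
      by (simp add: posterior_mean_def v'_def inner_diff_left inner_diff_right inner_add_right \<beta> \<alpha>_def
          algebra_simps)
    also have "- \<alpha> * \<nu> = (\<Sum>j = m..<m + k. c' j \<bullet> w j \<omega>)"
      by (simp add: \<nu>_def c'_def \<gamma>_def sum_distrib_left sum_divide_distrib)
    then have "v' \<bullet> (x \<omega> - F \<omega>) - \<alpha> * \<nu>
        = b \<bullet> (x \<omega> - mu) + (\<Sum>j<m + k. c' j \<bullet> w j \<omega>)"
      unfolding sum_split bc(1) by (simp add: c'_def)
    finally show ?thesis .
  qed
  have noise: "(\<Sum>j = m..<m + k. c' j \<bullet> (Sw *v c' j)) = \<alpha>\<^sup>2 * (dir S \<bullet> (Sw *v dir S))"
  proof (cases "k = 0")
    \<comment> \<open>Without measurements \<open>sensing S\<close> is zero, hence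
      \<open>\<alpha>\<close> is zero and so are both sides.\<close>
    case True
    then show ?thesis by (simp add: \<alpha>_def \<beta>_def a)
  next
    case False
    have "(\<Sum>j = m..<m + k. c' j \<bullet> (Sw *v c' j))
        = (\<Sum>j = m..<m + k. \<gamma>\<^sup>2 * (dir S \<bullet> (Sw *v dir S)))"
      by (rule sum.cong) (auto simp: c'_def matrix_vector_mult_scaleR power2_eq_square)
    also have "\<dots> = real k * \<gamma>\<^sup>2 * (dir S \<bullet> (Sw *v dir S))" by simp
    also have "real k * \<gamma>\<^sup>2 = \<alpha>\<^sup>2"
      using False by (simp add: \<gamma>_def power_divide)
    finally show ?thesis .
  qed
  \<comment> \<open>The last factor equals \<open>1\<close> by \<open>gain_eq\<close>; inserting it
    separates the form of \<open>S\<close> at \<open>v'\<close> from the noise variance.\<close>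
  have "v \<bullet> (posterior_cov S *v v)
      = v \<bullet> (S *v v) - 2 * \<alpha> * \<beta> + \<alpha> * \<beta> * (gain S * (sensing S \<bullet> (S *v sensing S) + dir S \<bullet> (Sw *v dir S)))"
    unfolding posterior_cov_quadratic[OF S] gain_eq[OF S] \<beta>_def[symmetric] \<alpha>_def
    by (simp add: power2_eq_square)
  also have "\<dots> = v' \<bullet> (S *v v') + \<alpha>\<^sup>2 * (dir S \<bullet> (Sw *v dir S))"
    by (simp add: v'_def matrix_vector_mult_diff_distrib matrix_vector_mult_scaleR inner_diff_left
        inner_diff_right \<beta> \<beta>_def[symmetric] \<alpha>_def power2_eq_square algebra_simps)
  also have "\<dots> = b \<bullet> (S0 *v b) + (\<Sum>j<m + k. c' j \<bullet> (Sw *v c' j))"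
    unfolding sum_split noise bc(2) by (simp add: c'_def)
  finally show "\<exists>b c. (\<forall>\<omega>. v \<bullet> (x \<omega> - posterior_mean (\<lambda>j u. u \<bullet> (x \<omega> + w j \<omega>)) S m (F \<omega>))
        = b \<bullet> (x \<omega> - mu) + (\<Sum>j<m + repeats (top_eig S). c j \<bullet> w j \<omega>)) \<and>
      v \<bullet> (posterior_cov S *v v) = b \<bullet> (S0 *v b) + (\<Sum>j<m + repeats (top_eig S). c j \<bullet> (Sw *v c j))"
    using mean unfolding k_def by (intro exI[of _ b] exI[of _ c'] conjI allI)
qed

text \<open>The covariances and the number of measurements do not depend on the responses, so the loops
  for all outcomes are projections of a single loop on estimators.\<close>

lemma info_greedy_terminates:
  fixes x :: "'a \<Rightarrow> real^'n" and w :: "nat \<Rightarrow> 'a \<Rightarrow> real^'n" and l :: "'n \<Rightarrow> real"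
  assumes S: "covariance_matrix S"
    and l: "charpoly (matrix_inv Sw ** S) = (\<Prod>i\<in>UNIV. [:- l i, 1:])"
  obtains F S' m where
    "\<And>\<omega>. info_greedy pick eps p Sw mu S (\<lambda>j u. u \<bullet> (x \<omega> + w j \<omega>)) = Some (F \<omega>, S', m)"
    "m \<le> (\<Sum>i\<in>UNIV. repeats (l i))"
    "covariance_matrix S'" "max_eigenvalue S' \<le> eps\<^sup>2 / chi_squared_quantile CARD('n) p"
    "error_cov x w mu S F S' m"
proof -
  define N where "N = (\<Sum>i\<in>UNIV. repeats (l i))"
  define step :: "('a \<Rightarrow> real^'n) \<times> (real^'n^'n) \<times> nat \<Rightarrow> ('a \<Rightarrow> real^'n) \<times> (real^'n^'n) \<times> nat"
    where "step = (\<lambda>(F, T, m). (\<lambda>\<omega>. posterior_mean (\<lambda>j u. u \<bullet> (x \<omega> + w j \<omega>)) T m (F \<omega>),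
      posterior_cov T, m + repeats (top_eig T)))"
  define cont :: "('a \<Rightarrow> real^'n) \<times> (real^'n^'n) \<times> nat \<Rightarrow> bool"
    where "cont = (\<lambda>(F, T, m). \<not> max_eigenvalue T \<le> eps\<^sup>2 / chi_squared_quantile CARD('n) p)"
  \<comment> \<open>Measurements taken plus those still to be charged always equal the budget
    \<open>N\<close>. This bounds the count, and the remaining budget serves as the termination
    measure.\<close>
  define I :: "('a \<Rightarrow> real^'n) \<times> (real^'n^'n) \<times> nat \<Rightarrow> bool"
    where "I = (\<lambda>(F, T, m). covariance_matrix T \<and> error_cov x w mu S F T m \<and>
      (\<exists>l' :: 'n \<Rightarrow> real. charpoly (matrix_inv Sw ** T) = (\<Prod>i\<in>UNIV. [:- l' i, 1:]) \<and>
        m + (\<Sum>i\<in>UNIV. repeats (l' i)) = N))"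
  have I_step: "I (step s)" if Is: "I s" for s
  proof -
    obtain F T m where s: "s = (F, T, m)" by (cases s)
    obtain l' :: "'n \<Rightarrow> real" where T: "covariance_matrix T" and err: "error_cov x w mu S F T m"
      and l': "charpoly (matrix_inv Sw ** T) = (\<Prod>i\<in>UNIV. [:- l' i, 1:])"
      "m + (\<Sum>i\<in>UNIV. repeats (l' i)) = N"
      using Is by (auto simp: I_def s)
    obtain l'' :: "'n \<Rightarrow> real" where
      "charpoly (matrix_inv Sw ** posterior_cov T) = (\<Prod>i\<in>UNIV. [:- l'' i, 1:])"
      "repeats (top_eig T) + (\<Sum>i\<in>UNIV. repeats (l'' i)) = (\<Sum>i\<in>UNIV. repeats (l' i))"
      using charpoly_posterior_cov[OF T l'(1)] .
    then show ?thesis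
      using posterior_cov_covariance[OF T] error_cov_step[OF T err] l'(2)
      by (auto simp: I_def step_def s intro!: exI[of _ l''])
  qed
  have "error_cov x w mu S (\<lambda>_. mu) S 0"
    unfolding error_cov_def by auto
  then have "I ((\<lambda>_. mu), S, 0)" using S l by (auto simp: I_def N_def)
  \<comment> \<open>The body runs once before the first test, so the loop proper starts from the
    result of one step.\<close>
  then have I0: "I (step ((\<lambda>_. mu), S, 0))" by (rule I_step)
  have decreasing: "I (step s) \<and> N - snd (snd (step s)) < N - snd (snd s)" if "I s" "cont s" for s
  proof -
    obtain F T m where s: "s = (F, T, m)" by (cases s)
    \<comment> \<open>A state that does not stop must take a measurement, so the remaining budget
      shrinks strictly.\<close>
    have "repeats (top_eig T) \<noteq> 0"
      using that repeats_0_imp_stop[of T] by (auto simp: I_def cont_def s)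
    moreover have "snd (snd (step s)) \<le> N" using I_step[OF that(1)] by (auto simp: I_def)
    ultimately show ?thesis using I_step[OF that(1)] by (auto simp: s step_def)
  qed
  obtain t where t: "while_option cont step (step ((\<lambda>_. mu), S, 0)) = Some t"
    using measure_while_option_Some[where P = I and f = "\<lambda>s. N - snd (snd s)", OF decreasing I0]
    by blast
  have It: "I t" by (rule while_option_rule[where P = I, OF _ t I0]) (rule I_step)
  have stop: "\<not> cont t" by (rule while_option_stop[OF t])
  obtain F S' m where t_eq: "t = (F, S', m)" by (cases t)
  show thesis
  proof (rule that[of F S' m])
    fix \<omega>
    let ?sense = "\<lambda>j u. u \<bullet> (x \<omega> + w j \<omega>)"
    let ?proj = "\<lambda>(F, T, m). (F \<omega>, T, m)"
    \<comment> \<open>Evaluating the estimator at \<open>\<omega>\<close> commutes with the step,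
      and the stopping test does not look at the mean.\<close>
    have "map_option ?proj (while_option cont step (step ((\<lambda>_. mu), S, 0)))
        = while_option (\<lambda>s. \<not> info_greedy_stop eps p s) (info_greedy_step pick eps p Sw ?sense)
            (?proj (step ((\<lambda>_. mu), S, 0)))"
      by (rule while_option_commute)
        (auto simp: cont_def info_greedy_stop_def step_def info_greedy_step_eq)
    then show "info_greedy pick eps p Sw mu S ?sense = Some (F \<omega>, S', m)"
      unfolding info_greedy_def t t_eq by (simp add: step_def info_greedy_step_eq)
  qed (use It stop in \<open>auto simp: I_def cont_def t_eq N_def\<close>)
qed

end

text \<open>Every functional of the error is a combination of independent Gaussian vectors with
  variance given by \<open>S'\<close>, which determines the characteristic functions entering the
  norm estimate.\<close>

lemma (in prob_space) error_cov_prob: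
  fixes x :: "'a \<Rightarrow> real^'n" and w :: "nat \<Rightarrow> 'a \<Rightarrow> real^'n"
  assumes igs: "info_greedy_sensing pick eps p Sw"
    and x: "gaussian_vector M x mu S" and w: "\<And>j. gaussian_vector M (w j) 0 Sw"
    and indep: "indep_vars (\<lambda>_. borel) (case_nat x w) UNIV"
    and err: "info_greedy_sensing.error_cov Sw x w mu S F S' m"
    and S': "covariance_matrix S'" "max_eigenvalue S' \<le> eps\<^sup>2 / chi_squared_quantile CARD('n) p"
  shows "p \<le> prob {\<omega> \<in> space M. norm (x \<omega> - F \<omega>) < eps}"
proof -
  interpret info_greedy_sensing pick eps p Sw by fact
  have [measurable]: "x \<in> borel_measurable M" "w j \<in> borel_measurable M" for j
    using x w by (auto simp: gaussian_vector_def)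
  have meas: "(\<lambda>\<omega>. v \<bullet> (x \<omega> - F \<omega>)) \<in> borel_measurable M"
    and char: "char (distr M borel (\<lambda>\<omega>. v \<bullet> (x \<omega> - F \<omega>))) 1
      = of_real (exp (- (v \<bullet> (S' *v v)) / 2))" for v
  proof -
    obtain b c where bc: "\<And>\<omega>. v \<bullet> (x \<omega> - F \<omega>) = b \<bullet> (x \<omega> - mu) + (\<Sum>j<m. c j \<bullet> w j \<omega>)"
      "v \<bullet> (S' *v v) = b \<bullet> (S *v b) + (\<Sum>j<m. c j \<bullet> (Sw *v c j))"
      using spec[OF err[unfolded error_cov_def], of v] by auto
    show "(\<lambda>\<omega>. v \<bullet> (x \<omega> - F \<omega>)) \<in> borel_measurable M" unfolding bc(1) by measurable
    show "char (distr M borel (\<lambda>\<omega>. v \<bullet> (x \<omega> - F \<omega>))) 1 = of_real (exp (- (v \<bullet> (S' *v v)) / 2))"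
      unfolding bc using char_gaussian_combination[OF x w indep, of b c m 1] by simp
  qed
  \<comment> \<open>Measurability of a vector is checked on its coordinates, which are among the
    functionals treated above.\<close>
  have "(\<lambda>\<omega>. x \<omega> - F \<omega>) \<in> borel_measurable M"
    by (subst borel_measurable_euclidean_space) (use meas in \<open>simp add: inner_commute\<close>)
  from prob_gaussian_norm_ge[OF this char S'(1) p eps S'(2)] show ?thesis .
qed

theorem mainTheorem7:
  fixes P :: "'a measure"
    and x :: "'a \<Rightarrow> real^'n" and w :: "nat \<Rightarrow> 'a \<Rightarrow> real^'n"
    and mu :: "real^'n" and S Sw :: "real^'n^'n"
    and lam :: "'n \<Rightarrow> real"
    and pick :: "real^'n^'n \<Rightarrow> real^'n"
    and eps p :: real
  assumes "prob_space P"
    and "gaussian_vector P x mu S"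
    and "\<And>j. gaussian_vector P (w j) 0 Sw"
    and "prob_space.indep_vars P (\<lambda>_. borel) (case_nat x w) UNIV"
    and "invertible Sw"
    and "charpoly (matrix_inv Sw ** S) = (\<Prod>i\<in>UNIV. [:- lam i, 1:])"
    and "top_eigenvector_rule pick"
    and "0 < eps" and "0 < p" and "p < 1"
  shows "(\<forall>\<omega>\<in>space P. \<exists>xhat S' m.
            info_greedy pick eps p Sw mu S (\<lambda>j u. u \<bullet> (x \<omega> + w j \<omega>)) = Some (xhat, S', m) \<and>
            int m \<le> (\<Sum>i | lam i \<noteq> 0.
              max 0 \<lceil>chi_squared_quantile CARD('n) p / eps\<^sup>2 * max_eigenvalue Sw - 1 / lam i\<rceil>))
       \<and> measure P {\<omega> \<in> space P. \<exists>xhat S' m.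
            info_greedy pick eps p Sw mu S (\<lambda>j u. u \<bullet> (x \<omega> + w j \<omega>)) = Some (xhat, S', m) \<and>
            norm (x \<omega> - xhat) < eps} \<ge> p"
proof -
  interpret prob_space P by fact
  have S: "covariance_matrix S" and Sw: "covariance_matrix Sw"
    using assms(2) assms(3)[of 0] by (auto simp: gaussian_vector_def)
  interpret info_greedy_sensing pick eps p Sw
    by standard (use assms Sw in auto)
  obtain F S' m where run:
    "\<And>\<omega>. info_greedy pick eps p Sw mu S (\<lambda>j u. u \<bullet> (x \<omega> + w j \<omega>)) = Some (F \<omega>, S', m)"
    and m: "m \<le> (\<Sum>i\<in>UNIV. repeats (lam i))"
    and S': "covariance_matrix S'" "max_eigenvalue S' \<le> eps\<^sup>2 / chi_squared_quantile CARD('n) p"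
    and err: "error_cov x w mu S F S' m"
    by (rule info_greedy_terminates[OF S assms(6), where mu = mu and x = x and w = w]) (rule that)
  let ?c = "\<lambda>i. \<lceil>chi_squared_quantile CARD('n) p / eps\<^sup>2 * max_eigenvalue Sw - 1 / lam i\<rceil>"
  \<comment> \<open>Zero eigenvalues are charged nothing by \<open>repeats\<close>, so the
    restricted sum becomes a sum over all indices.\<close>
  have "(\<Sum>i | lam i \<noteq> 0. max 0 (?c i)) = (\<Sum>i\<in>UNIV. if lam i \<noteq> 0 then max 0 (?c i) else 0)"
    using sum.inter_filter[of UNIV "\<lambda>i. max 0 (?c i)" "\<lambda>i. lam i \<noteq> 0"] by simp
  also have "\<dots> = int (\<Sum>i\<in>UNIV. repeats (lam i))"
    unfolding of_nat_sum by (rule sum.cong) (auto simp: repeats_def)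
  finally have "int m \<le> (\<Sum>i | lam i \<noteq> 0. max 0 (?c i))"
    using m by (simp only: of_nat_le_iff)
  moreover have "p \<le> measure P {\<omega> \<in> space P. norm (x \<omega> - F \<omega>) < eps}"
    by (rule error_cov_prob[OF info_greedy_sensing_axioms assms(2-4) err S'])
  ultimately show ?thesis by (simp add: run)
qed

end
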